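(* Let $q$ be a prime power, $n\ge 2$ an integer, $d$ an even integer with $2\le d\le n$, and let $X(n,q)$ be the set of $n\times n$ Hermitian matrices over $\mathbb{F}_{q^2}$. Every $d$-code $Y$ in $X(n,q)$ satisfies \[ |Y|\le (-1)^{n+1}q^{n(n-d+1)}\frac{((-q)^{n-d+2}-1)+(-q)^n((-q)^{n-d+1}-1)}{(-q)^{n-d+2}-(-q)^{n-d+1}}. \]
   Context: For $x\in\mathbb{F}_{q^2}$ write $\overline{x}=x^q$; for a matrix $A$ over $\mathbb{F}_{q^2}$, $A^*$ denotes the conjugate transpose. A square matrix $A$ is Hermitian if $A^*=A$. A nonempty subset $Y\subseteq X(n,q)$ is a $d$-code if $\operatorname{rank}(A-B)\ge d$ for all distinct $A,B\in Y$. *)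

theory Defs
  imports "Jordan_Normal_Form.DL_Rank" "HOL-Computational_Algebra.Primes"
begin

definition conjq :: "nat \<Rightarrow> 'a::field \<Rightarrow> 'a" where
  "conjq q x = x ^ q"

text \<open>X(n,q): n x n Hermitian matrices (A^* = A) over the field 'a = F_{q^2}.\<close>
definition hermitian_mats :: "nat \<Rightarrow> nat \<Rightarrow> 'a::field mat set" where
  "hermitian_mats n q = {A \<in> carrier_mat n n.
      \<forall>i<n. \<forall>j<n. A $$ (i, j) = conjq q (A $$ (j, i))}"

definition mrank :: "nat \<Rightarrow> 'a::field mat \<Rightarrow> nat" where
  "mrank n A = vec_space.rank n A"

definition is_d_code :: "nat \<Rightarrow> nat \<Rightarrow> nat \<Rightarrow> 'a::field mat set \<Rightarrow> bool" where
  "is_d_code n q d Y \<longleftrightarrow> Y \<noteq> {} \<and> Y \<subseteq> hermitian_mats n q \<and>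
     (\<forall>A\<in>Y. \<forall>B\<in>Y. A \<noteq> B \<longrightarrow> mrank n (A - B) \<ge> d)"

end

theory Submission
  imports
    Defs
    "Jordan_Normal_Form.Matrix_Kernel"
    "Berlekamp_Zassenhaus.Berlekamp_Type_Based"
    "HOL-Number_Theory.Residues"
begin

text \<open>
  Put \<open>b = - q\<close> and let \<open>\<psi>\<close> be an additive character of the field, nontrivial on the subfield of
  order \<open>q\<close>. The Gauss sum \<open>g(C)\<close> of a Hermitian matrix \<open>C\<close>, the sum of \<open>\<psi> (x\<^sup>* C x)\<close> over all
  vectors \<open>x\<close>, equals \<open>b\<close> to the power \<open>2 n - rank C\<close>: bordering \<open>C\<close> by a column \<open>C w\<close> completes
  the square and multiplies \<open>g\<close> by \<open>b\<close> or \<open>b\<^sup>2\<close>, while bordering by a column outside the image of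
  \<open>C\<close> leaves it unchanged.

  The \<open>t\<close>-th power of \<open>g\<close> is a sum of characters indexed by Gram matrices of \<open>t\<close>-tuples of vectors,
  which have rank at most \<open>t\<close>; so the Fourier transform of a polynomial of degree less than \<open>d\<close> in
  \<open>g(C)\<close> vanishes on matrices of rank at least \<open>d\<close>. Delsarte's linear programming argument then
  bounds \<open>|Y|\<close> by the sum over all \<open>C\<close> of \<open>f(C)\<close> divided by \<open>f(0)\<close>, for every nonnegative such
  polynomial \<open>f\<close>. With \<open>z = g(C) / b\<^sup>n\<close>, the choice is
  \<open>f = (- 1)\<^sup>n (z - 1) (z - b) \<dots> (z - b\<^bsup>d - 3\<^esup>) (z - b\<^bsup>n - 1\<^esup>)\<close>, and its sum over all Hermitian
  matrices follows by induction on \<open>n\<close>, again by bordering.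
\<close>

subsection \<open>Finite fields\<close>

lemma sum_eq_0_if_bij_scales:
  fixes f :: "'b \<Rightarrow> 'c::idom"
  assumes "bij_betw h S S" and "\<And>x. x \<in> S \<Longrightarrow> f (h x) = w * f x" and "w \<noteq> 1"
  shows "sum f S = 0"
proof -
  have "sum f S = (\<Sum>x\<in>S. f (h x))"
    using sum.reindex_bij_betw[OF assms(1), of f] by simp
  also have "\<dots> = w * sum f S"
    using assms(2) by (simp add: sum_distrib_left)
  finally have "(1 - w) * sum f S = 0" by (simp add: algebra_simps)
  then show ?thesis using assms(3) by simp
qed

lemma sum_card_fibres:
  assumes "finite A" and "finite B" and "f ` A \<subseteq> B"
  shows "(\<Sum>y\<in>B. card {x \<in> A. f x = y}) = card A"
  using sum.group[OF assms, of "\<lambda>_. 1 :: nat"] by simp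

lemma
  fixes f :: "'b \<Rightarrow> 'c"
  assumes fin: "finite A" "finite B" and img: "f ` A \<subseteq> B"
    and fibre_le: "\<And>y. y \<in> B \<Longrightarrow> card {x \<in> A. f x = y} \<le> m"
    and card_B_le: "card B \<le> k" and card_A: "card A = k * m" and "m > 0"
  shows pigeonhole_tight_card_codomain: "card B = k"
    and pigeonhole_tight_card_fibre: "y \<in> B \<Longrightarrow> card {x \<in> A. f x = y} = m"
proof -
  have total: "(\<Sum>y\<in>B. card {x \<in> A. f x = y}) = k * m"
    using sum_card_fibres[OF fin img] card_A by simp
  moreover have "(\<Sum>y\<in>B. card {x \<in> A. f x = y}) \<le> card B * m"
    using sum_bounded_above[of B "\<lambda>y. card {x \<in> A. f x = y}" m] fibre_le by simp
  ultimately show card_B: "card B = k"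
    using card_B_le \<open>m > 0\<close> by simp
  assume y: "y \<in> B"
  show "card {x \<in> A. f x = y} = m"
  proof (rule ccontr)
    assume "card {x \<in> A. f x = y} \<noteq> m"
    then have "card {x \<in> A. f x = y} < m" using fibre_le[OF y] by simp
    then have "(\<Sum>y\<in>B. card {x \<in> A. f x = y}) < (\<Sum>y\<in>B. m)"
      using y fibre_le fin by (intro sum_strict_mono_ex1) auto
    then show False using total card_B by simp
  qed
qed

lemma card_power_eq_poly_le:
  fixes r :: "'a::idom poly"
  assumes "degree r < m"
  shows "card {x. x ^ m = poly r x} \<le> m"
proof -
  define p where "p = Polynomial.monom 1 m + - r"
  have "degree p = m"
    unfolding p_def using assms by (subst degree_add_eq_left) (auto simp: degree_monom_eq)
  moreover from this have "p \<noteq> 0" using assms by auto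
  ultimately have "card {x. poly p x = 0} \<le> m"
    using card_poly_roots_bound[of p] by simp
  then show ?thesis by (simp add: p_def poly_monom)
qed

lemma ex_sum_powers_neq_0:
  assumes "I \<subseteq> {..<CARD('a::{finite,field})}" and "I \<noteq> {}"
  shows "\<exists>x::'a. (\<Sum>i\<in>I. x ^ i) \<noteq> 0"
proof (rule ccontr)
  assume vanish: "\<nexists>x::'a. (\<Sum>i\<in>I. x ^ i) \<noteq> 0"
  define p :: "'a poly" where "p = (\<Sum>i\<in>I. Polynomial.monom 1 i)"
  have fin: "finite I" using assms(1) finite_subset by blast
  have "degree p < CARD('a)"
    unfolding p_def using fin assms(1)
    by (intro degree_sum_less) (auto simp: degree_monom_eq)
  moreover have "poly p x = poly 0 x" for x
    using vanish by (simp add: p_def poly_sum poly_monom)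
  ultimately have "p = 0" by (intro poly_eqI_degree[of UNIV]) auto
  moreover obtain i where "i \<in> I" using assms(2) by blast
  then have "coeff p i = 1"
    using fin by (simp add: p_def coeff_sum)
  ultimately show False by simp
qed

text \<open>The library's \<open>finite_field_power_card_eq_same\<close> is stated for the class \<open>finite_field\<close>, of
  which the sort \<open>{finite, field}\<close> is not a subsort.\<close>

lemma power_card_eq_same:
  fixes x :: "'a::{finite,field}"
  shows "x ^ CARD('a) = x"
proof (cases "x = 0")
  case False
  let ?U = "UNIV - {0 :: 'a}"
  have "(\<Prod>y\<in>?U. y) = (\<Prod>y\<in>?U. x * y)"
    by (rule prod.reindex_bij_witness[of _ "\<lambda>y. x * y" "\<lambda>y. y / x"]) (use False in auto)
  also have "\<dots> = x ^ card ?U * (\<Prod>y\<in>?U. y)"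
    by (simp add: prod.distrib)
  finally have "x ^ card ?U = 1" by simp
  moreover have "CARD('a) = Suc (card ?U)"
    using card.remove[of UNIV "0 :: 'a"] by simp
  ultimately show ?thesis by (metis mult.right_neutral power_Suc)
qed simp

lemma prime_CHAR_finite: "prime CHAR('a::{finite,field})"
  using prime_CHAR_semidom finite_imp_CHAR_pos[where ?'a = 'a] by simp

subsection \<open>Additive characters\<close>

locale additive_character =
  fixes \<psi> :: "'a::ab_group_add \<Rightarrow> complex"
  assumes add: "\<psi> (x + y) = \<psi> x * \<psi> y"
    and norm_eq_1 [simp]: "norm (\<psi> x) = 1"
begin

lemma zero [simp]: "\<psi> 0 = 1"
  using add[of 0 0] norm_eq_1[of 0] by (metis add_0 mult_cancel_left2 norm_zero zero_neq_one)

lemma mult_cnj [simp]: "\<psi> x * cnj (\<psi> x) = 1"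
  using complex_norm_square[of "\<psi> x"] by simp

lemma diff: "\<psi> (x - y) = \<psi> x * cnj (\<psi> y)"
  using add[of "x - y" y] by (simp add: mult.assoc)

lemma sum: "\<psi> (sum f A) = (\<Prod>i\<in>A. \<psi> (f i))"
  by (induction A rule: infinite_finite_induct) (simp_all add: add)

end

lemma prime_field_eq_of_nat:
  "{x :: 'a::{finite,field}. x ^ CHAR('a) = x} = of_nat ` {..<CHAR('a)}"
proof (rule card_subset_eq[symmetric])
  let ?p = "CHAR('a)"
  have "of_nat k ^ ?p = (of_nat k :: 'a)" for k
    by (induction k) (simp_all add: freshmans_dream prime_CHAR_finite prime_gt_0_nat)
  then show subset: "of_nat ` {..<?p} \<subseteq> {x :: 'a. x ^ ?p = x}" by auto
  have "card {x :: 'a. x ^ ?p = x} \<le> ?p"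
    using card_power_eq_poly_le[of "[:0, 1 :: 'a:]" ?p]
      prime_gt_1_nat[OF prime_CHAR_finite[where ?'a = 'a]] by simp
  moreover have "inj_on (of_nat :: nat \<Rightarrow> 'a) {..<?p}"
    by (auto simp: inj_on_def of_nat_eq_iff_cong_CHAR cong_def)
  then have "card (of_nat ` {..<?p} :: 'a set) = ?p" by (simp add: card_image)
  moreover have "card (of_nat ` {..<?p} :: 'a set) \<le> card {x :: 'a. x ^ ?p = x}"
    using subset by (intro card_mono) auto
  ultimately show "card (of_nat ` {..<?p} :: 'a set) = card {x :: 'a. x ^ ?p = x}" by simp
qed simp

definition prime_field_character :: "'a::{finite,field} \<Rightarrow> complex" where
  "prime_field_character x = cis (2 * pi / CHAR('a)) ^ (SOME k. of_nat k = x)"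

lemma prime_field_character_of_nat:
  "prime_field_character (of_nat k :: 'a::{finite,field}) = cis (2 * pi / CHAR('a)) ^ k"
proof -
  let ?p = "CHAR('a)" and ?\<omega> = "cis (2 * pi / CHAR('a))"
  have "?\<omega> ^ ?p = 1"
    using prime_gt_0_nat[OF prime_CHAR_finite[where ?'a = 'a]] by (simp add: DeMoivre)
  then have power_mod: "?\<omega> ^ j = ?\<omega> ^ (j mod ?p)" for j
    by (metis mult.left_neutral mult_div_mod_eq power_add power_mult power_one)
  have "of_nat (SOME j. of_nat j = (of_nat k :: 'a)) = (of_nat k :: 'a)"
    by (rule someI[of "\<lambda>j. of_nat j = (of_nat k :: 'a)"]) (rule refl)
  then have "(SOME j. of_nat j = (of_nat k :: 'a)) mod ?p = k mod ?p"
    by (simp add: of_nat_eq_iff_cong_CHAR cong_def)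
  then show ?thesis unfolding prime_field_character_def using power_mod by metis
qed

lemma prime_field_character_of_nat_neq_1:
  assumes "0 < k" and "k < CHAR('a::{finite,field})"
  shows "prime_field_character (of_nat k :: 'a) \<noteq> 1"
proof -
  have "inj_on (\<lambda>k. cis (2 * pi * real k / real CHAR('a))) {..<CHAR('a)}"
    using bij_betw_roots_unity[of "CHAR('a)"] assms by (simp add: bij_betw_def)
  from inj_onD[OF this, of k 0] assms have "cis (2 * pi * real k / real CHAR('a)) \<noteq> 1" by auto
  then show ?thesis by (simp add: prime_field_character_of_nat DeMoivre mult_ac)
qed

definition absolute_trace :: "nat \<Rightarrow> 'a::field \<Rightarrow> 'a" where
  "absolute_trace m x = (\<Sum>i<m. x ^ (CHAR('a) ^ i))"

lemma absolute_trace_add: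
  fixes x y :: "'a::{finite,field}"
  shows "absolute_trace m (x + y) = absolute_trace m x + absolute_trace m y"
  by (simp add: absolute_trace_def freshmans_dream' prime_CHAR_finite sum.distrib)

lemma absolute_trace_in_prime_field:
  fixes x :: "'a::{finite,field}"
  assumes "CARD('a) = CHAR('a) ^ m"
  shows "absolute_trace m x ^ CHAR('a) = absolute_trace m x"
proof -
  have "absolute_trace m x ^ CHAR('a) = (\<Sum>i<m. x ^ (CHAR('a) ^ Suc i))"
    by (simp add: absolute_trace_def freshmans_dream_sum prime_CHAR_finite mult.commute
        flip: power_mult)
  also have "\<dots> + x = (\<Sum>i<Suc m. x ^ (CHAR('a) ^ i))"
    by (subst sum.lessThan_Suc_shift) (simp add: add.commute)
  also have "\<dots> = absolute_trace m x + x"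
    using power_card_eq_same[of x] by (simp add: absolute_trace_def assms)
  finally show ?thesis by simp
qed

lemma ex_absolute_trace_neq_0:
  assumes "CARD('a::{finite,field}) = CHAR('a) ^ m"
  shows "\<exists>x::'a. absolute_trace m x \<noteq> 0"
proof -
  have CHAR_gt_1: "CHAR('a) > 1" using prime_gt_1_nat[OF prime_CHAR_finite] .
  have "CARD('a) > 1" using card_mono[of UNIV "{0, 1 :: 'a}"] by simp
  then have "m > 0" using assms by (cases m) auto
  then have "\<exists>x::'a. (\<Sum>j\<in>(\<lambda>i. CHAR('a) ^ i) ` {..<m}. x ^ j) \<noteq> 0"
    using CHAR_gt_1 by (intro ex_sum_powers_neq_0) (auto simp: assms)
  then show ?thesis
    using CHAR_gt_1 by (simp add: absolute_trace_def sum.reindex inj_on_def)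
qed

lemma ex_nontrivial_additive_character:
  assumes "CARD('a::{finite,field}) = CHAR('a) ^ m"
  shows "\<exists>\<psi> :: 'a \<Rightarrow> complex. additive_character \<psi> \<and> \<psi> 1 \<noteq> 1"
proof -
  have of_nat: "\<exists>k<CHAR('a). absolute_trace m x = of_nat k" for x :: 'a
    using absolute_trace_in_prime_field[OF assms, of x] prime_field_eq_of_nat by blast
  obtain u :: 'a where u: "absolute_trace m u \<noteq> 0"
    using ex_absolute_trace_neq_0[OF assms] by blast
  define \<psi> where "\<psi> x = prime_field_character (absolute_trace m (u * x))" for x
  have "\<psi> (x + y) = \<psi> x * \<psi> y" for x y
  proof -
    obtain k l where kl: "absolute_trace m (u * x) = of_nat k" "absolute_trace m (u * y) = of_nat l"
      using of_nat by blast
    then have "absolute_trace m (u * (x + y)) = of_nat (k + l)"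
      by (simp add: distrib_left absolute_trace_add)
    then show ?thesis
      by (simp add: \<psi>_def kl prime_field_character_of_nat power_add del: of_nat_add)
  qed
  moreover have "norm (\<psi> x) = 1" for x
    using of_nat[of "u * x"] by (auto simp: \<psi>_def prime_field_character_of_nat norm_power)
  moreover have "\<psi> 1 \<noteq> 1"
  proof -
    obtain k where k: "k < CHAR('a)" "absolute_trace m u = of_nat k" using of_nat by blast
    then have "k > 0" using u by (cases k) auto
    then show ?thesis using prime_field_character_of_nat_neq_1[OF _ k(1)] by (simp add: \<psi>_def k(2))
  qed
  ultimately show ?thesis unfolding additive_character_def by blast
qed

subsection \<open>The quadratic extension\<close>

locale quadratic_extension =
  fixes q :: nat and field_type :: "'a::{finite,field} itself"
  assumes q_char_power: "\<exists>k. q = CHAR('a) ^ k"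
    and card_field: "CARD('a) = q ^ 2"
begin

abbreviation bar :: "'a \<Rightarrow> 'a" where "bar \<equiv> conjq q"

lemma q_gt_1: "q > 1"
proof -
  have "card {0, 1 :: 'a} \<le> CARD('a)" by (rule card_mono) auto
  then have "q ^ 2 \<ge> 2" by (simp add: card_field)
  then show ?thesis by (cases "q = 0 \<or> q = 1") auto
qed

sublocale bar: field_hom bar
proof
  show "bar (x + y) = bar x + bar y" for x y
    using q_char_power prime_CHAR_finite[where ?'a = 'a] by (auto simp: conjq_def freshmans_dream')
qed (use q_gt_1 in \<open>simp_all add: conjq_def power_mult_distrib power_0_left\<close>)

declare bar.hom_add [simp] bar.hom_mult [simp] bar.hom_sum [simp]

lemma bar_bar [simp]: "bar (bar x) = x"
  using power_card_eq_same[of x]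
  by (simp add: conjq_def card_field power2_eq_square power_mult)

definition fixed_field :: "'a set" where "fixed_field = {x. bar x = x}"

definition field_trace :: "'a \<Rightarrow> 'a" where "field_trace x = x + bar x"

definition field_norm :: "'a \<Rightarrow> 'a" where "field_norm x = x * bar x"

lemma field_norm_in_fixed_field: "field_norm x \<in> fixed_field"
  by (simp add: field_norm_def fixed_field_def mult.commute)

lemma field_norm_0 [simp]: "field_norm 0 = 0"
  by (simp add: field_norm_def)

lemma field_norm_eq_0_iff [simp]: "field_norm x = 0 \<longleftrightarrow> x = 0"
  using bar_bar[of x] by (auto simp: field_norm_def simp del: bar_bar)

lemma field_trace_0 [simp]: "field_trace 0 = 0"
  by (simp add: field_trace_def)

lemma field_trace_add: "field_trace (x + y) = field_trace x + field_trace y"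
  by (simp add: field_trace_def)

lemma field_trace_diff: "field_trace (x - y) = field_trace x - field_trace y"
  by (simp add: field_trace_def bar.hom_minus)

lemma zero_in_fixed_field: "0 \<in> fixed_field"
  by (simp add: fixed_field_def)

lemma card_fixed_field: "card fixed_field = q"
  and card_field_norm_fibre: "c \<in> fixed_field - {0} \<Longrightarrow> card {y. field_norm y = c} = q + 1"
proof -
  let ?U = "UNIV - {0 :: 'a}" and ?K = "fixed_field - {0}"
  have fibre: "{y \<in> ?U. field_norm y = c} = {y. field_norm y = c}" if "c \<in> ?K" for c
    using that by auto
  have image: "field_norm ` ?U \<subseteq> ?K"
    using field_norm_in_fixed_field by auto
  have fibre_le: "card {y \<in> ?U. field_norm y = c} \<le> q + 1" if "c \<in> ?K" for c
    unfolding fibre[OF that] using card_power_eq_poly_le[of "[:c:]" "q + 1"]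
    by (simp add: field_norm_def conjq_def)
  have "card fixed_field \<le> q"
    using card_power_eq_poly_le[of "[:0, 1 :: 'a:]" q] q_gt_1
    by (simp add: fixed_field_def conjq_def)
  then have K_le: "card ?K \<le> q - 1"
    using zero_in_fixed_field by simp
  have "card ?U = (q - 1) * (q + 1)"
    using q_gt_1 by (simp add: card_field power2_eq_square algebra_simps)
  note tight = image fibre_le K_le this
  have "card ?K = q - 1"
    by (rule pigeonhole_tight_card_codomain[OF _ _ tight]) auto
  then show "card fixed_field = q"
    using q_gt_1 card_Suc_Diff1[of fixed_field 0] zero_in_fixed_field by simp
  show "card {y. field_norm y = c} = q + 1" if c: "c \<in> ?K"
    using pigeonhole_tight_card_fibre[OF _ _ tight _ c] fibre[OF c] by simp
qed

lemma ex_field_trace_mult_eq_1: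
  assumes "c \<noteq> 0"
  shows "\<exists>s. field_trace (s * c) = 1"
proof -
  have "{1, q} \<subseteq> {..<CARD('a)}"
    using q_gt_1 less_1_mult[OF q_gt_1 q_gt_1] by (simp add: card_field power2_eq_square)
  from ex_sum_powers_neq_0[OF this] obtain u :: 'a where u: "field_trace u \<noteq> 0"
    using q_gt_1 by (auto simp: field_trace_def conjq_def)
  have "bar (field_trace u) = field_trace u"
    by (simp add: field_trace_def add.commute)
  then have "field_trace (u / field_trace u) = field_trace u / field_trace u"
    by (simp only: field_trace_def[of "u / field_trace u"] bar.hom_div)
      (simp only: field_trace_def add_divide_distrib)
  then show ?thesis
    using u assms by (intro exI[of _ "u / field_trace u / c"]) simp
qed

end

subsection \<open>Hermitian matrices and forms\<close>

lemma sum_carrier_vec_Suc: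
  fixes f :: "'b::finite vec \<Rightarrow> 'c::comm_monoid_add"
  shows "(\<Sum>w\<in>carrier_vec (Suc n). f w) = (\<Sum>y\<in>UNIV. \<Sum>x\<in>carrier_vec n. f (vCons y x))"
proof -
  have "bij_betw (\<lambda>(y, x). vCons y x) (UNIV \<times> carrier_vec n) (carrier_vec (Suc n) :: 'b vec set)"
    unfolding bij_betw_def
  proof (intro conjI equalityI subsetI)
    fix w :: "'b vec" assume "w \<in> carrier_vec (Suc n)"
    then show "w \<in> (\<lambda>(y, x). vCons y x) ` (UNIV \<times> carrier_vec n)"
      by (cases w) auto
  qed (auto simp: inj_on_def)
  from sum.reindex_bij_betw[OF this, of f] show ?thesis
    by (simp add: sum.cartesian_product case_prod_beta)
qed

lemma bij_betw_add_vec: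
  fixes w :: "'b::ab_group_add vec"
  assumes "w \<in> carrier_vec n"
  shows "bij_betw (\<lambda>x. x + w) (carrier_vec n) (carrier_vec n)"
  using assms
  by (intro bij_betw_byWitness[where f' = "\<lambda>x. x - w"]) (auto intro!: eq_vecI)

lemma card_image_mult_card_mat_kernel:
  fixes A :: "'b::{finite,field} mat"
  assumes A: "A \<in> carrier_mat nr nc"
  shows "card ((*\<^sub>v) A ` carrier_vec nc) * card (mat_kernel A) = CARD('b) ^ nc"
proof -
  have fibre: "card {x \<in> carrier_vec nc. A *\<^sub>v x = A *\<^sub>v w} = card (mat_kernel A)"
    if w: "w \<in> carrier_vec nc" for w
  proof (rule bij_betw_same_card)
    show "bij_betw (\<lambda>x. x - w) {x \<in> carrier_vec nc. A *\<^sub>v x = A *\<^sub>v w} (mat_kernel A)"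
      using w A
      by (intro bij_betw_byWitness[where f' = "\<lambda>x. x + w"])
        (auto simp: mat_kernel[OF A] mult_add_distrib_mat_vec mult_minus_distrib_mat_vec
          intro!: eq_vecI)
  qed
  have "CARD('b) ^ nc
      = (\<Sum>v\<in>(*\<^sub>v) A ` carrier_vec nc. card {x \<in> carrier_vec nc. A *\<^sub>v x = v})"
    by (simp add: sum_card_fibres card_carrier_vec)
  also have "\<dots> = (\<Sum>v\<in>(*\<^sub>v) A ` carrier_vec nc. card (mat_kernel A))"
    using fibre by (intro sum.cong) auto
  finally show ?thesis by simp
qed

context quadratic_extension
begin

abbreviation V :: "nat \<Rightarrow> 'a vec set" where "V \<equiv> carrier_vec"
abbreviation X :: "nat \<Rightarrow> 'a mat set" where "X n \<equiv> hermitian_mats n q"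

lemma card_V: "card (V n) = q ^ (2 * n)"
  by (simp add: card_carrier_vec card_field power_mult)

lemma X_carrier: "C \<in> X n \<Longrightarrow> C \<in> carrier_mat n n"
  by (simp add: hermitian_mats_def)

lemma X_dim [simp]: "C \<in> X n \<Longrightarrow> dim_row C = n" "C \<in> X n \<Longrightarrow> dim_col C = n"
  by (auto dest: X_carrier)

lemma X_mult_mat_vec [simp]: "C \<in> X n \<Longrightarrow> C *\<^sub>v x \<in> V n"
  by (intro carrier_vecI) simp

lemma X_index: "C \<in> X n \<Longrightarrow> i < n \<Longrightarrow> j < n \<Longrightarrow> C $$ (j, i) = bar (C $$ (i, j))"
  unfolding hermitian_mats_def by blast

lemma X_I:
  assumes "C \<in> carrier_mat n n" and "\<And>i j. i < n \<Longrightarrow> j < n \<Longrightarrow> C $$ (j, i) = bar (C $$ (i, j))"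
  shows "C \<in> X n"
  unfolding hermitian_mats_def using assms by blast

lemma X_transpose: "C \<in> X n \<Longrightarrow> transpose_mat C = map_mat bar C"
  by (intro eq_matI) (auto intro: X_index)

lemma zero_in_X: "0\<^sub>m n n \<in> X n"
  by (simp add: hermitian_mats_def)

lemma X_add:
  assumes "A \<in> X n" and "B \<in> X n"
  shows "A + B \<in> X n"
proof (rule X_I)
  fix i j assume "i < n" "j < n"
  then show "(A + B) $$ (j, i) = bar ((A + B) $$ (i, j))"
    using assms X_index[of A n i j] X_index[of B n i j] by simp
qed (use assms X_carrier in auto)

lemma X_diff:
  assumes "A \<in> X n" and "B \<in> X n"
  shows "A - B \<in> X n"
proof (rule X_I)
  fix i j assume "i < n" "j < n"
  then show "(A - B) $$ (j, i) = bar ((A - B) $$ (i, j))"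
    using assms X_index[of A n i j] X_index[of B n i j] by (simp add: bar.hom_minus)
qed (use assms(2) in \<open>auto dest: X_carrier\<close>)

lemma bij_betw_add_X:
  assumes "E \<in> X n"
  shows "bij_betw (\<lambda>C. C + E) (X n) (X n)"
  using assms by (intro bij_betw_byWitness[where f' = "\<lambda>C. C - E"])
    (auto simp: X_add X_diff intro!: eq_matI)

definition herm_prod :: "'a vec \<Rightarrow> 'a vec \<Rightarrow> 'a" where
  "herm_prod x y = map_vec bar x \<bullet> y"

definition herm_form :: "'a mat \<Rightarrow> 'a vec \<Rightarrow> 'a" where
  "herm_form C x = herm_prod x (C *\<^sub>v x)"

lemma herm_prod_add_left:
  assumes "x \<in> V n" and "y \<in> V n" and "w \<in> V n"
  shows "herm_prod (x + y) w = herm_prod x w + herm_prod y w"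
  using assms by (simp add: herm_prod_def scalar_prod_def sum.distrib distrib_right)

lemma herm_prod_diff_left:
  assumes "x \<in> V n" and "y \<in> V n" and "w \<in> V n"
  shows "herm_prod (x - y) w = herm_prod x w - herm_prod y w"
  using assms
  by (simp add: herm_prod_def scalar_prod_def sum_subtractf left_diff_distrib bar.hom_minus)

lemma herm_prod_add_right:
  assumes "x \<in> V n" and "y \<in> V n" and "w \<in> V n"
  shows "herm_prod w (x + y) = herm_prod w x + herm_prod w y"
  using assms by (simp add: herm_prod_def scalar_prod_add_distrib[of _ n])

lemma herm_prod_smult_right:
  assumes "x \<in> V n" and "y \<in> V n"
  shows "herm_prod x (s \<cdot>\<^sub>v y) = s * herm_prod x y"
  using assms by (simp add: herm_prod_def)

lemma herm_prod_zero_left [simp]: "y \<in> V n \<Longrightarrow> herm_prod (0\<^sub>v n) y = 0"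
  by (simp add: herm_prod_def scalar_prod_def)

lemma herm_prod_zero_right [simp]: "x \<in> V n \<Longrightarrow> herm_prod x (0\<^sub>v n) = 0"
  by (simp add: herm_prod_def)

lemma bar_herm_prod:
  assumes "x \<in> V n" and "y \<in> V n"
  shows "bar (herm_prod x y) = herm_prod y x"
  using assms by (simp add: herm_prod_def scalar_prod_def mult.commute)

lemma herm_prod_self_adjoint:
  assumes C: "C \<in> X n" and "x \<in> V n" and "y \<in> V n"
  shows "herm_prod (C *\<^sub>v x) y = herm_prod x (C *\<^sub>v y)"
proof -
  have "map_vec bar (C *\<^sub>v x) = transpose_mat C *\<^sub>v map_vec bar x"
    using assms by (simp add: bar.mult_mat_vec_hom[OF X_carrier[OF C]] X_transpose)
  then show ?thesis
    using transpose_vec_mult_scalar[OF X_carrier[OF C], of y "map_vec bar x"] assms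
    by (simp add: herm_prod_def)
qed

lemma herm_form_in_fixed_field:
  assumes "C \<in> X n" and "x \<in> V n"
  shows "herm_form C x \<in> fixed_field"
  using assms
  by (simp add: herm_form_def fixed_field_def bar_herm_prod[of _ n] herm_prod_self_adjoint)

lemma herm_form_add:
  assumes C: "C \<in> X n" and x: "x \<in> V n" and y: "y \<in> V n"
  shows "herm_form C (x + y) = herm_form C x + herm_form C y + field_trace (herm_prod x (C *\<^sub>v y))"
proof -
  have "herm_prod y (C *\<^sub>v x) = bar (herm_prod x (C *\<^sub>v y))"
    using C x y by (simp add: bar_herm_prod[of _ n] herm_prod_self_adjoint)
  then show ?thesis
    using C x y X_carrier[OF C]
    by (simp add: herm_form_def field_trace_def mult_add_distrib_mat_vec
        herm_prod_add_left[of _ n] herm_prod_add_right[of _ n])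
qed

lemma herm_form_smult:
  assumes "C \<in> X n" and "x \<in> V n"
  shows "herm_form C (s \<cdot>\<^sub>v x) = field_norm s * herm_form C x"
  using assms X_carrier[OF assms(1)]
  by (simp add: herm_form_def herm_prod_def bar.vec_hom_smult mult_mat_vec field_norm_def)

lemma ex_field_trace_herm_prod_eq_1:
  assumes x: "x \<in> V n" and "x \<noteq> 0\<^sub>v n"
  shows "\<exists>v\<in>V n. field_trace (herm_prod x v) = 1"
proof -
  obtain i where i: "i < n" "x $ i \<noteq> 0"
    using assms by (metis carrier_vecD eq_vecI index_zero_vec(1,2))
  then obtain s where s: "field_trace (s * bar (x $ i)) = 1"
    using ex_field_trace_mult_eq_1[of "bar (x $ i)"] by auto
  have "herm_prod x (s \<cdot>\<^sub>v unit_vec n i) = s * bar (x $ i)"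
    using x i by (simp add: herm_prod_def)
  then show ?thesis
    using s by (intro bexI[of _ "s \<cdot>\<^sub>v unit_vec n i"]) simp_all
qed

definition border :: "'a \<Rightarrow> 'a vec \<Rightarrow> 'a mat \<Rightarrow> 'a mat" where
  "border a v C = mat (Suc (dim_row C)) (Suc (dim_row C)) (\<lambda>(i, j).
     case i of 0 \<Rightarrow> vCons a (map_vec bar v) $ j | Suc k \<Rightarrow> vCons (v $ k) (row C k) $ j)"

lemma border_in_X:
  assumes "a \<in> fixed_field" and "v \<in> V n" and "C \<in> X n"
  shows "border a v C \<in> X (Suc n)"
proof (rule X_I)
  show "border a v C \<in> carrier_mat (Suc n) (Suc n)" using assms by (simp add: border_def)
  fix i j assume "i < Suc n" "j < Suc n"
  then show "border a v C $$ (j, i) = bar (border a v C $$ (i, j))"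
    using assms X_index[OF assms(3), of "i - 1" "j - 1"]
    by (cases i; cases j) (auto simp: border_def fixed_field_def)
qed

lemma border_cases:
  assumes "D \<in> X (Suc n)"
  obtains a v C where "a \<in> fixed_field" and "v \<in> V n" and "C \<in> X n" and "D = border a v C"
proof
  let ?a = "D $$ (0, 0)" and ?v = "vec n (\<lambda>i. D $$ (Suc i, 0))"
    and ?C = "mat n n (\<lambda>(i, j). D $$ (Suc i, Suc j))"
  show "?a \<in> fixed_field" using X_index[OF assms, of 0 0, symmetric] by (simp add: fixed_field_def)
  show "?v \<in> V n" by simp
  show "?C \<in> X n" by (rule X_I) (auto intro: X_index[OF assms])
  show "D = border ?a ?v ?C"
  proof (rule eq_matI)
    fix i j assume "i < dim_row (border ?a ?v ?C)" "j < dim_col (border ?a ?v ?C)"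
    then have "i < Suc n" "j < Suc n" by (simp_all add: border_def)
    then show "D $$ (i, j) = border ?a ?v ?C $$ (i, j)"
      using X_index[OF assms, of j 0, symmetric] by (cases i; cases j) (auto simp: border_def)
  qed (use assms in \<open>auto simp: border_def\<close>)
qed

lemma border_eq_border_iff:
  assumes "v \<in> V n" and "v' \<in> V n" and "C \<in> X n" and "C' \<in> X n"
  shows "border a v C = border a' v' C' \<longleftrightarrow> a = a' \<and> v = v' \<and> C = C'"
proof
  assume eq: "border a v C = border a' v' C'"
  have "a = a'"
    using arg_cong[OF eq, of "\<lambda>D. D $$ (0, 0)"] by (simp add: border_def)
  moreover have "v $ i = v' $ i" if "i < n" for i
    using arg_cong[OF eq, of "\<lambda>D. D $$ (Suc i, 0)"] assms that by (simp add: border_def)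
  moreover have "C $$ (i, j) = C' $$ (i, j)" if "i < n" "j < n" for i j
    using arg_cong[OF eq, of "\<lambda>D. D $$ (Suc i, Suc j)"] assms that by (simp add: border_def)
  ultimately show "a = a' \<and> v = v' \<and> C = C'"
    using assms by (auto intro!: eq_vecI eq_matI)
qed simp

lemma bij_betw_border:
  "bij_betw (\<lambda>(a, v, C). border a v C) (fixed_field \<times> V n \<times> X n) (X (Suc n))"
  unfolding bij_betw_def
proof (intro conjI equalityI subsetI)
  show "inj_on (\<lambda>(a, v, C). border a v C) (fixed_field \<times> V n \<times> X n)"
    by (auto simp: inj_on_def border_eq_border_iff[of _ n])
next
  fix D assume "D \<in> X (Suc n)"
  then obtain a v C where "(a, v, C) \<in> fixed_field \<times> V n \<times> X n" and "D = border a v C"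
    by (auto elim: border_cases)
  then show "D \<in> (\<lambda>(a, v, C). border a v C) ` (fixed_field \<times> V n \<times> X n)"
    by force
next
  fix D assume "D \<in> (\<lambda>(a, v, C). border a v C) ` (fixed_field \<times> V n \<times> X n)"
  then show "D \<in> X (Suc n)" by (auto simp: border_in_X)
qed

lemma X_0: "X 0 = {0\<^sub>m 0 0}"
  by (auto simp: hermitian_mats_def intro!: eq_matI)

lemma finite_X: "finite (X n)"
proof (induction n)
  case (Suc n)
  then show ?case using bij_betw_finite[OF bij_betw_border, of n] by simp
qed (simp add: X_0)

lemma sum_X_Suc:
  fixes f :: "'a mat \<Rightarrow> 'c::comm_monoid_add"
  shows "(\<Sum>D\<in>X (Suc n). f D) = (\<Sum>C\<in>X n. \<Sum>v\<in>V n. \<Sum>a\<in>fixed_field. f (border a v C))"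
proof -
  have "(\<Sum>D\<in>X (Suc n). f D) = (\<Sum>a\<in>fixed_field. \<Sum>v\<in>V n. \<Sum>C\<in>X n. f (border a v C))"
    unfolding sum.reindex_bij_betw[OF bij_betw_border, symmetric]
    by (simp add: sum.cartesian_product case_prod_beta)
  also have "\<dots> = (\<Sum>v\<in>V n. \<Sum>C\<in>X n. \<Sum>a\<in>fixed_field. f (border a v C))"
    by (subst sum.swap, rule sum.cong[OF refl], rule sum.swap)
  also have "\<dots> = (\<Sum>C\<in>X n. \<Sum>v\<in>V n. \<Sum>a\<in>fixed_field. f (border a v C))"
    by (rule sum.swap)
  finally show ?thesis .
qed

lemma border_mult_vCons:
  assumes C: "C \<in> X n" and v: "v \<in> V n" and x: "x \<in> V n"
  shows "border a v C *\<^sub>v vCons y x = vCons (a * y + herm_prod v x) (y \<cdot>\<^sub>v v + C *\<^sub>v x)"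
proof (rule eq_vecI)
  fix i assume "i < dim_vec (vCons (a * y + herm_prod v x) (y \<cdot>\<^sub>v v + C *\<^sub>v x))"
  then have i: "i < Suc n" using C by simp
  have "row (border a v C) 0 = vCons a (map_vec bar v)"
    using C v by (intro eq_vecI) (auto simp: border_def)
  moreover have "row (border a v C) (Suc k) = vCons (v $ k) (row C k)" if "k < n" for k
    using C that by (intro eq_vecI) (auto simp: border_def)
  moreover have "dim_row (border a v C) = Suc n" using C by (simp add: border_def)
  ultimately show "(border a v C *\<^sub>v vCons y x) $ i
      = vCons (a * y + herm_prod v x) (y \<cdot>\<^sub>v v + C *\<^sub>v x) $ i"
    using i C v x by (cases i) (simp_all add: herm_prod_def mult.commute)
qed (use C in \<open>simp add: border_def\<close>)

lemma herm_form_border: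
  assumes C: "C \<in> X n" and v: "v \<in> V n" and x: "x \<in> V n"
  shows "herm_form (border a v C) (vCons y x)
    = herm_form C x + field_trace (herm_prod x (y \<cdot>\<^sub>v v)) + a * field_norm y"
proof -
  have "map_vec bar (vCons y x) = vCons (bar y) (map_vec bar x)"
    by (intro eq_vecI) (auto simp: vec_index_vCons)
  then have "herm_form (border a v C) (vCons y x)
      = bar y * (a * y + herm_prod v x) + herm_prod x (y \<cdot>\<^sub>v v + C *\<^sub>v x)"
    by (simp add: herm_form_def border_mult_vCons[OF assms]) (simp add: herm_prod_def)
  also have "bar y * herm_prod v x = bar (herm_prod x (y \<cdot>\<^sub>v v))"
    using v x by (simp add: herm_prod_smult_right bar_herm_prod[of _ n])
  then have "bar y * (a * y + herm_prod v x) + herm_prod x (y \<cdot>\<^sub>v v + C *\<^sub>v x)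
      = herm_form C x + field_trace (herm_prod x (y \<cdot>\<^sub>v v)) + a * field_norm y"
    using C v x
    by (simp add: herm_prod_add_right[of _ n] field_trace_def field_norm_def herm_form_def
        distrib_left mult_ac)
  finally show ?thesis .
qed

end

subsection \<open>Gauss sums\<close>

locale hermitian_forms = quadratic_extension q "TYPE('a)" + psi: additive_character \<psi>
  for q and \<psi> :: "'a::{finite,field} \<Rightarrow> complex" +
  assumes psi_1: "\<psi> 1 \<noteq> 1"
begin

abbreviation b :: real where "b \<equiv> - real q"

lemma sum_psi_fixed_field:
  assumes "a \<in> fixed_field" and "a \<noteq> 0"
  shows "(\<Sum>c\<in>fixed_field. \<psi> (a * c)) = 0"
proof (rule sum_eq_0_if_bij_scales[where h = "\<lambda>c. c + 1 / a", OF _ _ psi_1])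
  have "1 / a \<in> fixed_field" using assms by (simp add: fixed_field_def bar.hom_div)
  then show "bij_betw (\<lambda>c. c + 1 / a) fixed_field fixed_field"
    by (intro bij_betw_byWitness[where f' = "\<lambda>c. c - 1 / a"])
      (auto simp: fixed_field_def bar.hom_minus)
  show "\<psi> (a * (c + 1 / a)) = \<psi> 1 * \<psi> (a * c)" for c
    using assms by (simp add: distrib_left psi.add)
qed

lemma sum_psi_field_norm:
  assumes "a \<in> fixed_field"
  shows "(\<Sum>y\<in>UNIV. \<psi> (a * field_norm y)) = of_real (if a = 0 then b ^ 2 else b)"
proof (cases "a = 0")
  case True
  then show ?thesis by (simp add: card_field)
next
  case False
  let ?U = "UNIV - {0 :: 'a}" and ?K = "fixed_field - {0}"
  have "(\<Sum>y\<in>?U. \<psi> (a * field_norm y))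
      = (\<Sum>c\<in>?K. \<Sum>y\<in>{y \<in> ?U. field_norm y = c}. \<psi> (a * field_norm y))"
    by (rule sum.group[symmetric]) (auto simp: field_norm_in_fixed_field)
  also have "\<dots> = (\<Sum>c\<in>?K. \<Sum>y\<in>{y. field_norm y = c}. \<psi> (a * c))"
    by (intro sum.cong) auto
  also have "\<dots> = (of_nat q + 1) * (\<Sum>c\<in>?K. \<psi> (a * c))"
    using card_field_norm_fibre by (simp add: sum_distrib_left add.commute)
  also have "(\<Sum>c\<in>?K. \<psi> (a * c)) = - 1"
    using sum_psi_fixed_field[OF assms False] sum.remove[of fixed_field 0 "\<lambda>c. \<psi> (a * c)"]
    by (simp add: zero_in_fixed_field add_eq_0_iff)
  finally show ?thesis
    using False sum.remove[of UNIV 0 "\<lambda>y. \<psi> (a * field_norm y)"] by simp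
qed

lemma sum_psi_herm_prod:
  assumes x: "x \<in> V n"
  shows "(\<Sum>v\<in>V n. \<psi> (field_trace (herm_prod x v))) = (if x = 0\<^sub>v n then of_nat q ^ (2 * n) else 0)"
proof (cases "x = 0\<^sub>v n")
  case True
  then show ?thesis by (simp add: card_V)
next
  case False
  then obtain w where w: "w \<in> V n" "field_trace (herm_prod x w) = 1"
    using ex_field_trace_herm_prod_eq_1[OF x] by auto
  have "(\<Sum>v\<in>V n. \<psi> (field_trace (herm_prod x v))) = 0"
    by (rule sum_eq_0_if_bij_scales[OF bij_betw_add_vec[OF w(1)] _ psi_1])
      (use x w in \<open>simp add: herm_prod_add_right[of _ n] field_trace_add psi.add\<close>)
  then show ?thesis using False by simp
qed

lemma parseval:
  "(\<Sum>v\<in>V n. (norm (\<Sum>x\<in>V n. f x * \<psi> (field_trace (herm_prod x v))))\<^sup>2)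
    = real q ^ (2 * n) * (\<Sum>x\<in>V n. (norm (f x))\<^sup>2)"
proof -
  define e where "e x v = \<psi> (field_trace (herm_prod x v))" for x v
  have e_diff: "e x v * cnj (e y v) = e (x - y) v" if "x \<in> V n" "y \<in> V n" "v \<in> V n" for x y v
    using that by (simp add: e_def herm_prod_diff_left[of _ n] field_trace_diff psi.diff)
  have orthogonal: "(\<Sum>v\<in>V n. e x v * cnj (e y v)) = (if y = x then of_nat q ^ (2 * n) else 0)"
    if "x \<in> V n" "y \<in> V n" for x y
  proof -
    have "x - y = 0\<^sub>v n \<longleftrightarrow> y = x"
      using that by (auto simp: vec_eq_iff)
    then show ?thesis
      using that sum_psi_herm_prod[of "x - y" n] by (simp add: e_diff) (simp add: e_def card_V)
  qed
  have "complex_of_real (\<Sum>v\<in>V n. (norm (\<Sum>x\<in>V n. f x * e x v))\<^sup>2)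
      = (\<Sum>v\<in>V n. \<Sum>x\<in>V n. \<Sum>y\<in>V n. f x * cnj (f y) * (e x v * cnj (e y v)))"
    unfolding of_real_sum complex_norm_square by (simp add: sum_product mult_ac)
  also have "\<dots> = (\<Sum>x\<in>V n. \<Sum>v\<in>V n. \<Sum>y\<in>V n. f x * cnj (f y) * (e x v * cnj (e y v)))"
    by (rule sum.swap)
  also have "\<dots> = (\<Sum>x\<in>V n. \<Sum>y\<in>V n. f x * cnj (f y) * (\<Sum>v\<in>V n. e x v * cnj (e y v)))"
    unfolding sum_distrib_left by (rule sum.cong[OF refl], rule sum.swap)
  also have "\<dots> = (\<Sum>x\<in>V n. \<Sum>y\<in>V n. if y = x then f x * cnj (f x) * of_nat q ^ (2 * n) else 0)"
    by (intro sum.cong refl) (simp add: orthogonal)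
  also have "\<dots> = of_real (real q ^ (2 * n) * (\<Sum>x\<in>V n. (norm (f x))\<^sup>2))"
    unfolding of_real_mult of_real_sum complex_norm_square by (simp add: sum_distrib_left mult_ac)
  finally show ?thesis unfolding e_def of_real_eq_iff .
qed

definition gauss_sum :: "'a mat \<Rightarrow> complex" where
  "gauss_sum C = (\<Sum>x\<in>V (dim_row C). \<psi> (herm_form C x))"

definition twisted_gauss_sum :: "'a mat \<Rightarrow> 'a vec \<Rightarrow> complex" where
  "twisted_gauss_sum C v
    = (\<Sum>x\<in>V (dim_row C). \<psi> (herm_form C x) * \<psi> (field_trace (herm_prod x v)))"

lemma gauss_sum_translate:
  assumes "C \<in> X n" and "y \<in> V n"
  shows "gauss_sum C = (\<Sum>x\<in>V n. \<psi> (herm_form C (x + y)))"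
  using assms sum.reindex_bij_betw[OF bij_betw_add_vec, of y n "\<lambda>x. \<psi> (herm_form C x)"]
  by (simp add: gauss_sum_def)

lemma twisted_gauss_sum_zero: "C \<in> X n \<Longrightarrow> twisted_gauss_sum C (0\<^sub>v n) = gauss_sum C"
  by (simp add: twisted_gauss_sum_def gauss_sum_def)

lemma twisted_gauss_sum_image:
  assumes C: "C \<in> X n" and w: "w \<in> V n"
  shows "twisted_gauss_sum C (C *\<^sub>v w) = gauss_sum C * cnj (\<psi> (herm_form C w))"
proof -
  have "gauss_sum C = twisted_gauss_sum C (C *\<^sub>v w) * \<psi> (herm_form C w)"
    using C by (simp add: gauss_sum_translate[OF assms] twisted_gauss_sum_def
        herm_form_add[OF C _ w] psi.add sum_distrib_left mult_ac)
  then show ?thesis by (simp add: mult.assoc)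
qed

lemma norm_gauss_sum:
  assumes C: "C \<in> X n"
  shows "(norm (gauss_sum C))\<^sup>2 = real q ^ (2 * n) * card (mat_kernel C)"
proof -
  have "complex_of_real ((norm (gauss_sum C))\<^sup>2)
      = (\<Sum>y\<in>V n. \<Sum>u\<in>V n. \<psi> (herm_form C (u + y)) * cnj (\<psi> (herm_form C y)))"
    using C unfolding complex_norm_square
    by (subst (2) gauss_sum_def)
      (simp add: sum_distrib_left gauss_sum_translate[OF C] sum_distrib_right)
  also have "\<dots> = (\<Sum>u\<in>V n. \<Sum>y\<in>V n. \<psi> (herm_form C u) * \<psi> (field_trace (herm_prod (C *\<^sub>v u) y)))"
  proof (subst sum.swap, intro sum.cong refl)
    fix u y assume uy: "u \<in> V n" "y \<in> V n"
    have "herm_form C (u + y) - herm_form C y = herm_form C u + field_trace (herm_prod (C *\<^sub>v u) y)"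
      using herm_form_add[OF C uy] herm_prod_self_adjoint[OF C uy] by simp
    then show "\<psi> (herm_form C (u + y)) * cnj (\<psi> (herm_form C y))
        = \<psi> (herm_form C u) * \<psi> (field_trace (herm_prod (C *\<^sub>v u) y))"
      by (metis psi.add psi.diff)
  qed
  also have "\<dots> = (\<Sum>u\<in>V n. if u \<in> mat_kernel C then of_nat q ^ (2 * n) else 0)"
    using C by (intro sum.cong refl)
      (simp add: sum_psi_herm_prod mat_kernel[OF X_carrier] herm_form_def flip: sum_distrib_left)
  also have "\<dots> = (\<Sum>u\<in>mat_kernel C. of_nat q ^ (2 * n))"
    using mat_kernel_carrier[OF X_carrier[OF C]] by (simp add: sum.If_cases Int_absorb1)
  also have "\<dots> = complex_of_real (real q ^ (2 * n) * card (mat_kernel C))" by simp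
  finally show ?thesis unfolding of_real_eq_iff .
qed

text \<open>The twists by the image of \<open>C\<close> already exhaust the total mass given by Parseval's identity.\<close>

lemma twisted_gauss_sum_eq_0:
  assumes C: "C \<in> X n" and v: "v \<in> V n" "v \<notin> (*\<^sub>v) C ` V n"
  shows "twisted_gauss_sum C v = 0"
proof -
  let ?mass = "\<lambda>v. (norm (twisted_gauss_sum C v))\<^sup>2" and ?I = "(*\<^sub>v) C ` V n"
  have image_subset: "?I \<subseteq> V n" using C by auto
  have "real (card ?I) * real (card (mat_kernel C)) = real q ^ (2 * n)"
    using card_image_mult_card_mat_kernel[OF X_carrier[OF C]]
    by (simp add: card_field power_mult flip: of_nat_mult)
  moreover have "?mass u = real q ^ (2 * n) * card (mat_kernel C)" if "u \<in> ?I" for u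
    using that C by (auto simp: twisted_gauss_sum_image norm_mult norm_gauss_sum)
  then have "(\<Sum>u\<in>?I. ?mass u) = real q ^ (2 * n) * (real (card ?I) * real (card (mat_kernel C)))"
    by simp
  ultimately have "(\<Sum>u\<in>?I. ?mass u) = real q ^ (2 * n) * real q ^ (2 * n)"
    by (simp only:)
  moreover have "(\<Sum>u\<in>V n. ?mass u) = real q ^ (2 * n) * real q ^ (2 * n)"
    using C parseval[where n = n and f = "\<lambda>x. \<psi> (herm_form C x)"]
    by (simp add: twisted_gauss_sum_def card_V)
  ultimately have "(\<Sum>u\<in>V n - ?I. ?mass u) = 0"
    using image_subset by (simp add: sum_diff)
  then show ?thesis using v by (simp add: sum_nonneg_eq_0_iff)
qed

lemma gauss_sum_border:
  assumes C: "C \<in> X n" and v: "v \<in> V n"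
  shows "gauss_sum (border a v C) = (\<Sum>y\<in>UNIV. \<psi> (a * field_norm y) * twisted_gauss_sum C (y \<cdot>\<^sub>v v))"
proof -
  have "dim_row (border a v C) = Suc n" using C by (simp add: border_def)
  then have "gauss_sum (border a v C) = (\<Sum>y\<in>UNIV. \<Sum>x\<in>V n. \<psi> (herm_form (border a v C) (vCons y x)))"
    by (simp add: gauss_sum_def sum_carrier_vec_Suc)
  also have "\<dots> = (\<Sum>y\<in>UNIV. \<psi> (a * field_norm y) * twisted_gauss_sum C (y \<cdot>\<^sub>v v))"
    using C by (intro sum.cong refl)
      (simp add: herm_form_border[OF C v] psi.add twisted_gauss_sum_def sum_distrib_left mult_ac)
  finally show ?thesis .
qed

lemma gauss_sum_border_image:
  assumes C: "C \<in> X n" and w: "w \<in> V n" and a: "a \<in> fixed_field"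
  shows "gauss_sum (border a (C *\<^sub>v w) C)
    = gauss_sum C * of_real (if a = herm_form C w then b ^ 2 else b)"
proof -
  let ?c = "a - herm_form C w"
  have "\<psi> (a * field_norm y) * twisted_gauss_sum C (y \<cdot>\<^sub>v (C *\<^sub>v w))
      = gauss_sum C * \<psi> (?c * field_norm y)" for y
  proof -
    have "y \<cdot>\<^sub>v (C *\<^sub>v w) = C *\<^sub>v (y \<cdot>\<^sub>v w)"
      using w X_carrier[OF C] by (simp add: mult_mat_vec)
    then have "twisted_gauss_sum C (y \<cdot>\<^sub>v (C *\<^sub>v w))
        = gauss_sum C * cnj (\<psi> (herm_form C w * field_norm y))"
      using w by (simp add: twisted_gauss_sum_image[OF C] herm_form_smult[OF C] mult.commute)
    then show ?thesis by (simp add: left_diff_distrib psi.diff)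
  qed
  then have "gauss_sum (border a (C *\<^sub>v w) C) = gauss_sum C * (\<Sum>y\<in>UNIV. \<psi> (?c * field_norm y))"
    using C by (simp add: gauss_sum_border[OF C] sum_distrib_left)
  moreover have "?c \<in> fixed_field"
    using herm_form_in_fixed_field[OF C w] a by (simp add: fixed_field_def bar.hom_minus)
  ultimately show ?thesis by (simp add: sum_psi_field_norm)
qed

lemma gauss_sum_border_not_image:
  assumes C: "C \<in> X n" and v: "v \<in> V n" "v \<notin> (*\<^sub>v) C ` V n"
  shows "gauss_sum (border a v C) = gauss_sum C"
proof -
  have "twisted_gauss_sum C (y \<cdot>\<^sub>v v) = 0" if "y \<noteq> 0" for y
  proof (rule twisted_gauss_sum_eq_0[OF C])
    show "y \<cdot>\<^sub>v v \<notin> (*\<^sub>v) C ` V n"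
    proof
      assume "y \<cdot>\<^sub>v v \<in> (*\<^sub>v) C ` V n"
      then obtain w where w: "w \<in> V n" "y \<cdot>\<^sub>v v = C *\<^sub>v w" by auto
      then have "C *\<^sub>v ((1 / y) \<cdot>\<^sub>v w) = (1 / y) \<cdot>\<^sub>v (y \<cdot>\<^sub>v v)"
        using X_carrier[OF C] by (simp add: mult_mat_vec)
      also have "\<dots> = v" using \<open>y \<noteq> 0\<close> by (simp add: smult_smult_assoc)
      finally show False using v(2) w(1) by (metis imageI smult_carrier_vec)
    qed
  qed (use v in simp)
  then have "gauss_sum (border a v C) = twisted_gauss_sum C (0 \<cdot>\<^sub>v v)"
    unfolding gauss_sum_border[OF C v(1)]
    by (subst sum.remove[of _ "0 :: 'a"]) (auto intro!: sum.neutral)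
  also have "0 \<cdot>\<^sub>v v = 0\<^sub>v n" using v(1) by auto
  finally show ?thesis using twisted_gauss_sum_zero[OF C] by simp
qed

lemma gauss_sum_eq_power:
  assumes "C \<in> X n"
  shows "\<exists>e. gauss_sum C = of_real (b ^ e)"
  using assms
proof (induction n arbitrary: C)
  case 0
  have "V 0 = {0\<^sub>v 0}" by auto
  then have "gauss_sum C = of_real (b ^ 0)"
    using 0 by (simp add: gauss_sum_def herm_form_def herm_prod_def scalar_prod_def)
  then show ?case by blast
next
  case (Suc n)
  obtain a v D where C: "C = border a v D" and D: "a \<in> fixed_field" "v \<in> V n" "D \<in> X n"
    using border_cases[OF Suc.prems] by metis
  obtain e where gauss_D: "gauss_sum D = of_real (b ^ e)" using Suc.IH[OF D(3)] by blast
  show ?case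
  proof (cases "v \<in> (*\<^sub>v) D ` V n")
    case True
    then obtain w where w: "w \<in> V n" "v = D *\<^sub>v w" by auto
    define k :: nat where "k = (if a = herm_form D w then 2 else 1)"
    have "gauss_sum C = of_real (b ^ (e + k))"
      unfolding C w(2) gauss_sum_border_image[OF D(3) w(1) D(1)] gauss_D
      by (simp add: k_def power_add)
    then show ?thesis by blast
  next
    case False
    then show ?thesis using gauss_sum_border_not_image[OF D(3,2)] gauss_D C by auto
  qed
qed

text \<open>In terms of the rank, \<open>gauss_sum C = b ^ (2 * n - rank C)\<close> and \<open>zeta C = b ^ (n - rank C)\<close>;
  the size of the kernel is all that is used.\<close>

definition zeta :: "'a mat \<Rightarrow> real" where
  "zeta C = Re (gauss_sum C) / b ^ dim_row C"

lemma b_nonzero: "b \<noteq> 0"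
  using q_gt_1 by simp

lemma gauss_sum_eq_zeta:
  assumes "C \<in> X n"
  shows "gauss_sum C = of_real (b ^ n * zeta C)"
  using gauss_sum_eq_power[OF assms] assms b_nonzero
  by (auto simp: zeta_def simp flip: of_real_power of_real_minus)

lemma zeta_eqI:
  assumes "C \<in> X n" and "gauss_sum C = of_real (b ^ n * z)"
  shows "zeta C = z"
  using assms b_nonzero by (simp add: zeta_def del: of_real_mult)

lemma card_mat_kernel_eq_zeta:
  assumes C: "C \<in> X n"
  shows "real (card (mat_kernel C)) = zeta C ^ 2"
proof -
  have "real q ^ (2 * n) * card (mat_kernel C) = (b ^ n * zeta C)\<^sup>2"
    using norm_gauss_sum[OF C] by (simp only: gauss_sum_eq_zeta[OF C] norm_of_real power2_abs)
  also have "\<dots> = real q ^ (2 * n) * zeta C ^ 2"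
    by (simp add: power_mult_distrib power_mult power2_eq_square flip: power_mult_distrib)
  finally show ?thesis using q_gt_1 by simp
qed

lemma card_image_eq_zeta:
  assumes C: "C \<in> X n"
  shows "real (card ((*\<^sub>v) C ` V n)) * zeta C ^ 2 = b ^ (2 * n)"
  using card_image_mult_card_mat_kernel[OF X_carrier[OF C]]
  by (simp add: card_field power_mult flip: card_mat_kernel_eq_zeta[OF C] of_nat_mult)

lemma zeta_nonzero:
  assumes "C \<in> X n"
  shows "zeta C \<noteq> 0"
  using card_image_eq_zeta[OF assms] b_nonzero by auto

lemma zeta_eq_power:
  assumes C: "C \<in> X n"
  shows "\<exists>k\<le>n. zeta C = b ^ k"
proof -
  obtain e where "gauss_sum C = of_real (b ^ e)" using gauss_sum_eq_power[OF C] by blast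
  then have power_e: "b ^ n * zeta C = b ^ e"
    by (simp only: gauss_sum_eq_zeta[OF C] of_real_eq_iff)
  have square: "(b ^ k)\<^sup>2 = real (q ^ (2 * k))" for k
    by (simp add: power_mult power2_eq_square flip: power_mult_distrib)
  have "real (q ^ (2 * e)) = real (q ^ (2 * n) * card (mat_kernel C))"
    by (simp only: square[symmetric] power_e[symmetric] power_mult_distrib of_nat_mult
        card_mat_kernel_eq_zeta[OF C])
  then have kernel: "q ^ (2 * e) = q ^ (2 * n) * card (mat_kernel C)" by (simp only: of_nat_eq_iff)
  have "card (mat_kernel C) \<le> q ^ (2 * n)"
    using card_mono[OF finite_carrier_vec mat_kernel_carrier[OF X_carrier[OF C]]]
    by (simp add: card_V)
  moreover have "card (mat_kernel C) > 0"
    using card_mat_kernel_eq_zeta[OF C] zeta_nonzero[OF C] by (cases "card (mat_kernel C)") auto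
  ultimately have "q ^ (2 * n) \<le> q ^ (2 * e)" "q ^ (2 * e) \<le> q ^ (2 * n) * q ^ (2 * n)"
    by (simp_all add: kernel)
  then have "n \<le> e" "e \<le> n + n" using q_gt_1 by (simp_all flip: power_add)
  then have "b ^ n * zeta C = b ^ n * b ^ (e - n)" "e - n \<le> n"
    using power_e by (simp_all flip: power_add)
  then show ?thesis using b_nonzero by auto
qed

lemma zeta_border_image:
  assumes C: "C \<in> X n" and w: "w \<in> V n" and a: "a \<in> fixed_field"
  shows "zeta (border a (C *\<^sub>v w) C) = (if a = herm_form C w then b * zeta C else zeta C)"
proof (rule zeta_eqI)
  show "border a (C *\<^sub>v w) C \<in> X (Suc n)" using a C by (simp add: border_in_X)
  show "gauss_sum (border a (C *\<^sub>v w) C)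
      = of_real (b ^ Suc n * (if a = herm_form C w then b * zeta C else zeta C))"
    unfolding gauss_sum_border_image[OF assms] gauss_sum_eq_zeta[OF C]
    by (simp add: power2_eq_square mult_ac)
qed

lemma zeta_border_not_image:
  assumes C: "C \<in> X n" and v: "v \<in> V n" "v \<notin> (*\<^sub>v) C ` V n" and a: "a \<in> fixed_field"
  shows "zeta (border a v C) = zeta C / b"
proof (rule zeta_eqI)
  show "border a v C \<in> X (Suc n)" using a C v by (simp add: border_in_X)
  show "gauss_sum (border a v C) = of_real (b ^ Suc n * (zeta C / b))"
    unfolding gauss_sum_border_not_image[OF C v] gauss_sum_eq_zeta[OF C]
    using b_nonzero by simp
qed

lemma sum_zeta_border:
  fixes f :: "real \<Rightarrow> real"
  assumes C: "C \<in> X n"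
  defines "z \<equiv> zeta C"
  shows "(\<Sum>v\<in>V n. \<Sum>a\<in>fixed_field. f (zeta (border a v C)))
    = b ^ (2 * n) / z ^ 2 * (f (b * z) + (- b - 1) * f z + (z ^ 2 - 1) * - b * f (z / b))"
proof -
  let ?I = "(*\<^sub>v) C ` V n" and ?s = "\<lambda>v. \<Sum>a\<in>fixed_field. f (zeta (border a v C))"
  have image_subset: "?I \<subseteq> V n" using C by auto
  have card_range: "real (card ?I) = b ^ (2 * n) / z ^ 2"
    using card_image_eq_zeta[OF C] zeta_nonzero[OF C] by (simp add: z_def field_simps)
  have "?s v = f (b * z) + (- b - 1) * f z" if "v \<in> ?I" for v
  proof -
    from that obtain w where w: "w \<in> V n" "v = C *\<^sub>v w" by auto
    have form: "herm_form C w \<in> fixed_field" using herm_form_in_fixed_field[OF C w(1)] .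
    then have "?s v = f (b * z) + (\<Sum>a\<in>fixed_field - {herm_form C w}. f z)"
      by (subst sum.remove[OF _ form])
        (auto simp: w(2) zeta_border_image[OF C w(1)] z_def intro!: sum.cong)
    then show ?thesis using form q_gt_1 by (simp add: card_fixed_field of_nat_diff)
  qed
  then have "(\<Sum>v\<in>?I. ?s v) = real (card ?I) * (f (b * z) + (- b - 1) * f z)"
    by simp
  moreover have "(\<Sum>v\<in>V n - ?I. ?s v) = (\<Sum>v\<in>V n - ?I. - b * f (z / b))"
    using C by (intro sum.cong refl) (auto simp: zeta_border_not_image z_def card_fixed_field)
  moreover have "real (card (V n - ?I)) = b ^ (2 * n) / z ^ 2 * (z ^ 2 - 1)"
  proof -
    have "real (card (V n - ?I)) = b ^ (2 * n) - real (card ?I)"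
      using image_subset card_mono[OF finite_carrier_vec image_subset]
      by (simp add: card_Diff_subset finite_subset[OF image_subset] card_V of_nat_diff)
    then show ?thesis using zeta_nonzero[OF C] by (simp add: card_range z_def field_simps)
  qed
  ultimately show ?thesis
    using sum.subset_diff[OF image_subset, of ?s] unfolding card_range
    by (simp add: distrib_left mult_ac)
qed

end

subsection \<open>Moments of the rank distribution\<close>

definition gauss_poly :: "'a::comm_ring_1 \<Rightarrow> nat \<Rightarrow> 'a poly" where
  "gauss_poly b r = (\<Prod>s<r. [:- (b ^ s), 1:])"

lemma poly_gauss_poly: "poly (gauss_poly b r) z = (\<Prod>s<r. z - b ^ s)"
  by (simp add: gauss_poly_def poly_prod)

lemma poly_gauss_poly_0 [simp]: "poly (gauss_poly b 0) z = 1"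
  by (simp add: poly_gauss_poly)

lemma poly_gauss_poly_Suc:
  "poly (gauss_poly b (Suc r)) z = poly (gauss_poly b r) z * (z - b ^ r)"
  by (simp add: poly_gauss_poly)

lemma degree_gauss_poly: "degree (gauss_poly (b :: 'a::idom) r) = r"
  unfolding gauss_poly_def by (subst degree_prod_eq_sum_degree) auto

lemma poly_gauss_poly_mult_base:
  "poly (gauss_poly b (Suc r)) (b * z) = (b * z - 1) * b ^ r * poly (gauss_poly b r) z"
proof (induction r)
  case (Suc r)
  show ?case
    unfolding poly_gauss_poly_Suc[of b "Suc r" "b * z"] Suc.IH poly_gauss_poly_Suc[of b r z]
    by (simp add: algebra_simps)
qed (simp add: poly_gauss_poly_Suc)

lemma poly_gauss_poly_divide_base:
  fixes b :: "'a::field"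
  assumes "b \<noteq> 0"
  shows "(z - 1) * poly (gauss_poly b r) (z / b) * b ^ r = poly (gauss_poly b (Suc r)) z"
  using poly_gauss_poly_mult_base[of b r "z / b"] assms by (simp add: mult_ac)

text \<open>Up to a factor, the left-hand side is the sum of \<open>p (Suc r)\<close> over all borderings of one
  matrix: \<open>b * z\<close>, \<open>z\<close> and \<open>z / b\<close> are the possible new values of \<open>z\<close>.\<close>

lemma gauss_poly_border_identity:
  fixes b z :: "'a::field"
  assumes "b \<noteq> 0"
  defines "p \<equiv> \<lambda>r. poly (gauss_poly b r)"
  shows "(p (Suc r) (b * z) + (- b - 1) * p (Suc r) z + (z ^ 2 - 1) * - b * p (Suc r) (z / b))
      * b ^ Suc r
    = - b * z ^ 2 * (p (Suc r) z + (1 - b ^ Suc r) * p r z)"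
proof -
  define P W c where "P = p r z" and "W = p (Suc r) (z / b)" and "c = b ^ r"
  have W_eq: "(z - 1) * W * (b * c) = P * (z - c) * (z - b * c)"
    using poly_gauss_poly_divide_base[OF assms(1), of z "Suc r"]
    by (simp add: p_def poly_gauss_poly_Suc P_def W_def c_def)
  have "((b * z - 1) * c * P + (- b - 1) * (P * (z - c)) + (z ^ 2 - 1) * - b * W) * (b * c)
      = ((b * z - 1) * c * P + (- b - 1) * (P * (z - c))) * (b * c)
        - b * (z + 1) * ((z - 1) * W * (b * c))"
    by (simp add: algebra_simps power2_eq_square)
  also have "\<dots> = - b * z ^ 2 * (P * (z - c) + (1 - b * c) * P)"
    unfolding W_eq by (simp add: algebra_simps power2_eq_square)
  finally show ?thesis
    by (simp add: p_def poly_gauss_poly_mult_base poly_gauss_poly_Suc[of b r z] P_def W_def c_def)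
qed

context hermitian_forms
begin

definition gauss_moment :: "nat \<Rightarrow> nat \<Rightarrow> real" where
  "gauss_moment n r = (\<Sum>C\<in>X n. poly (gauss_poly b r) (zeta C))"

lemma gauss_moment_Suc_0: "gauss_moment (Suc n) 0 = - (b ^ Suc (2 * n)) * gauss_moment n 0"
  unfolding gauss_moment_def sum_X_Suc by (simp add: card_fixed_field card_V mult_ac)

lemma gauss_moment_Suc_Suc:
  "gauss_moment (Suc n) (Suc r) * b ^ Suc r
    = - (b ^ Suc (2 * n)) * (gauss_moment n (Suc r) + (1 - b ^ Suc r) * gauss_moment n r)"
proof -
  let ?p = "\<lambda>r. poly (gauss_poly b r)"
  have "(\<Sum>v\<in>V n. \<Sum>a\<in>fixed_field. ?p (Suc r) (zeta (border a v C))) * b ^ Suc r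
      = - (b ^ Suc (2 * n)) * (?p (Suc r) (zeta C) + (1 - b ^ Suc r) * ?p r (zeta C))"
    if C: "C \<in> X n" for C
    unfolding sum_zeta_border[OF C] mult.assoc[of _ _ "b ^ Suc r"]
      gauss_poly_border_identity[OF b_nonzero]
    using zeta_nonzero[OF C] by simp
  then have "gauss_moment (Suc n) (Suc r) * b ^ Suc r
      = (\<Sum>C\<in>X n. - (b ^ Suc (2 * n)) * (?p (Suc r) (zeta C) + (1 - b ^ Suc r) * ?p r (zeta C)))"
    unfolding gauss_moment_def sum_X_Suc sum_distrib_right[of _ "X n"] by (intro sum.cong refl)
  then show ?thesis
    by (simp only: gauss_moment_def sum.distrib flip: sum_distrib_left)
qed

lemma gauss_moment_mult_power:
  "gauss_moment n r * b ^ (n * r) = (- 1) ^ (n + r) * b ^ (n ^ 2) * poly (gauss_poly b r) (b ^ n)"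
proof (induction n arbitrary: r)
  case 0
  have "zeta (0\<^sub>m 0 0) = 1" using zeta_eq_power[of "0\<^sub>m 0 0" 0] by (simp add: X_0)
  moreover have "poly (gauss_poly b r) 1 = (if r = 0 then 1 else 0)"
    by (auto simp: poly_gauss_poly intro!: bexI[of _ 0])
  ultimately show ?case by (simp add: gauss_moment_def X_0)
next
  case (Suc n)
  have "(Suc n)\<^sup>2 = Suc (2 * n) + n\<^sup>2" by (simp add: power2_eq_square)
  then have square: "b ^ (Suc n)\<^sup>2 = b ^ Suc (2 * n) * b ^ n\<^sup>2" by (simp only: power_add)
  show ?case
  proof (cases r)
    case 0
    then show ?thesis using Suc[of 0] unfolding square by (simp add: gauss_moment_Suc_0)
  next
    case (Suc s)
    let ?p = "poly (gauss_poly b s) (b ^ n)"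
    have "gauss_moment (Suc n) r * b ^ (Suc n * r)
        = gauss_moment (Suc n) (Suc s) * b ^ Suc s * b ^ (n * Suc s)"
      by (simp add: Suc power_add mult_ac)
    also have "\<dots> = - (b ^ Suc (2 * n)) * (gauss_moment n (Suc s) * b ^ (n * Suc s)
        + (1 - b ^ Suc s) * b ^ n * (gauss_moment n s * b ^ (n * s)))"
      unfolding gauss_moment_Suc_Suc by (simp add: power_add algebra_simps)
    also have "\<dots> = - (b ^ Suc (2 * n)) * ((- 1) ^ (n + Suc s) * b ^ n\<^sup>2 * (?p * (b ^ n - b ^ s))
        + (1 - b ^ Suc s) * b ^ n * ((- 1) ^ (n + s) * b ^ n\<^sup>2 * ?p))"
      unfolding Suc.IH poly_gauss_poly_Suc ..
    also have "\<dots> = (- 1) ^ (Suc n + r) * b ^ (Suc n)\<^sup>2 * ((b * b ^ n - 1) * b ^ s * ?p)"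
      unfolding square Suc by (simp add: algebra_simps)
    also have "\<dots> = (- 1) ^ (Suc n + r) * b ^ (Suc n)\<^sup>2 * poly (gauss_poly b r) (b ^ Suc n)"
      unfolding Suc power_Suc[of b n] poly_gauss_poly_mult_base ..
    finally show ?thesis .
  qed
qed

lemma gauss_moment_eq:
  assumes "r \<le> n"
  shows "gauss_moment n r = (- 1) ^ (n + r) * b ^ (n * (n - r)) * poly (gauss_poly b r) (b ^ n)"
proof -
  have "n\<^sup>2 = n * (n - r) + n * r"
    using assms by (simp add: power2_eq_square flip: distrib_left)
  then have "gauss_moment n r * b ^ (n * r)
      = ((- 1) ^ (n + r) * b ^ (n * (n - r)) * poly (gauss_poly b r) (b ^ n)) * b ^ (n * r)"
    unfolding gauss_moment_mult_power by (simp add: power_add)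
  then show ?thesis using b_nonzero by (metis mult_right_cancel power_not_zero)
qed

end

subsection \<open>Fourier transforms and the linear programming bound\<close>

lemma delsarte_bound:
  fixes \<chi> :: "'b \<Rightarrow> 'c \<Rightarrow> complex" and f :: "'c \<Rightarrow> real"
  assumes fin: "finite Y" "finite Z" and "Y \<noteq> {}"
    and unimodular: "\<And>A C. norm (\<chi> A C) = 1"
    and trivial: "C\<^sub>0 \<in> Z" "\<And>A. A \<in> Y \<Longrightarrow> \<chi> A C\<^sub>0 = 1"
    and nonneg: "\<And>C. C \<in> Z \<Longrightarrow> f C \<ge> 0"
    and vanish: "\<And>A B. A \<in> Y \<Longrightarrow> B \<in> Y \<Longrightarrow> A \<noteq> B \<Longrightarrow>
      (\<Sum>C\<in>Z. of_real (f C) * (\<chi> A C * cnj (\<chi> B C))) = 0"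
  shows "real (card Y) * f C\<^sub>0 \<le> (\<Sum>C\<in>Z. f C)"
proof -
  define F where "F C = (\<Sum>A\<in>Y. \<chi> A C)" for C
  have "\<chi> A C * cnj (\<chi> A C) = 1" for A C
    using complex_norm_square[of "\<chi> A C"] unimodular by simp
  then have orthogonal: "(\<Sum>C\<in>Z. of_real (f C) * (\<chi> A C * cnj (\<chi> B C)))
      = (if B = A then of_real (\<Sum>C\<in>Z. f C) else 0)" if "A \<in> Y" "B \<in> Y" for A B
    using that vanish by auto
  have "complex_of_real (\<Sum>C\<in>Z. f C * (norm (F C))\<^sup>2)
      = (\<Sum>C\<in>Z. \<Sum>A\<in>Y. \<Sum>B\<in>Y. of_real (f C) * (\<chi> A C * cnj (\<chi> B C)))"
    unfolding of_real_sum of_real_mult complex_norm_square F_def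
    by (simp add: sum_product) (simp add: sum_distrib_left)
  also have "\<dots> = (\<Sum>A\<in>Y. \<Sum>B\<in>Y. \<Sum>C\<in>Z. of_real (f C) * (\<chi> A C * cnj (\<chi> B C)))"
    by (subst sum.swap, rule sum.cong[OF refl], rule sum.swap)
  also have "\<dots> = (\<Sum>A\<in>Y. \<Sum>B\<in>Y. if B = A then of_real (\<Sum>C\<in>Z. f C) else 0)"
    by (intro sum.cong refl orthogonal)
  also have "\<dots> = of_real (real (card Y) * (\<Sum>C\<in>Z. f C))"
    using fin by simp
  finally have mass: "(\<Sum>C\<in>Z. f C * (norm (F C))\<^sup>2) = real (card Y) * (\<Sum>C\<in>Z. f C)"
    unfolding of_real_eq_iff .
  have "F C\<^sub>0 = of_nat (card Y)" using trivial by (simp add: F_def)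
  then have "f C\<^sub>0 * (real (card Y))\<^sup>2 = f C\<^sub>0 * (norm (F C\<^sub>0))\<^sup>2" by simp
  also have "\<dots> \<le> (\<Sum>C\<in>Z. f C * (norm (F C))\<^sup>2)"
    using nonneg fin trivial by (intro member_le_sum) auto
  finally have "real (card Y) * (real (card Y) * f C\<^sub>0) \<le> real (card Y) * (\<Sum>C\<in>Z. f C)"
    unfolding mass by (simp add: power2_eq_square mult_ac)
  then show ?thesis using fin \<open>Y \<noteq> {}\<close> by (simp add: card_gt_0_iff)
qed

lemma mrank_sum_products_le:
  fixes f g :: "nat \<Rightarrow> nat \<Rightarrow> 'b::field"
  shows "mrank n (mat n n (\<lambda>(i, j). \<Sum>s<t. f s i * g s j)) \<le> t"
proof (induction t)
  case 0
  have "mat n n (\<lambda>(i, j). \<Sum>s<0. f s i * g s j) = 0\<^sub>m n n" by (auto intro!: eq_matI)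
  then show ?case by (simp only: mrank_def vec_space.rank_0I le_refl)
next
  case (Suc t)
  let ?M = "\<lambda>t. mat n n (\<lambda>(i, j). \<Sum>s<t. f s i * g s j)" and ?E = "mat n n (\<lambda>(i, j). f t i * g t j)"
  have "?M (Suc t) = ?M t + ?E" by (auto intro!: eq_matI)
  moreover have "mrank n (?M t + ?E) \<le> mrank n (?M t) + mrank n ?E"
    unfolding mrank_def by (rule vec_space.rank_subadditive[where nc = n]) auto
  moreover have "mrank n ?E \<le> 1"
    unfolding mrank_def
    by (rule vec_space.rank_le_1_product_entries[where nc = n and f = "f t" and g = "g t"]) auto
  ultimately show ?case using Suc by simp
qed

definition mat_inner :: "'a::semiring_0 mat \<Rightarrow> 'a mat \<Rightarrow> 'a" where
  "mat_inner A C = (\<Sum>ij\<in>{..<dim_row A} \<times> {..<dim_col A}. A $$ ij * C $$ ij)"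

lemma mat_inner_zero_right [simp]: "A \<in> carrier_mat nr nc \<Longrightarrow> mat_inner A (0\<^sub>m nr nc) = 0"
  by (auto simp: mat_inner_def intro!: sum.neutral)

lemma mat_inner_add_left:
  "A \<in> carrier_mat nr nc \<Longrightarrow> B \<in> carrier_mat nr nc \<Longrightarrow>
    mat_inner (A + B) C = mat_inner A C + mat_inner B C"
  by (auto simp: mat_inner_def distrib_right simp flip: sum.distrib intro!: sum.cong)

lemma mat_inner_diff_left:
  fixes A B C :: "'a::ring mat"
  shows "A \<in> carrier_mat nr nc \<Longrightarrow> B \<in> carrier_mat nr nc \<Longrightarrow>
    mat_inner (A - B) C = mat_inner A C - mat_inner B C"
  by (auto simp: mat_inner_def left_diff_distrib simp flip: sum_subtractf intro!: sum.cong)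

lemma mat_inner_add_right:
  "A \<in> carrier_mat nr nc \<Longrightarrow> C \<in> carrier_mat nr nc \<Longrightarrow> D \<in> carrier_mat nr nc \<Longrightarrow>
    mat_inner A (C + D) = mat_inner A C + mat_inner A D"
  by (auto simp: mat_inner_def distrib_left simp flip: sum.distrib intro!: sum.cong)

context hermitian_forms
begin

lemma ex_mat_inner_eq_1:
  assumes D: "D \<in> X n" and "D \<noteq> 0\<^sub>m n n"
  shows "\<exists>E\<in>X n. mat_inner D E = 1"
proof -
  obtain i j where ij: "i < n" "j < n" "D $$ (i, j) \<noteq> 0"
    using assms X_carrier[OF D] by (metis carrier_matD eq_matI index_zero_mat)
  obtain s where s: "field_trace (s * D $$ (i, j)) = 1"
    using ex_field_trace_mult_eq_1[OF ij(3)] by blast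
  define E where "E = mat n n (\<lambda>kl. (if kl = (i, j) then s else 0)
    + (if kl = (j, i) then bar s else 0))"
  have E_index: "E $$ kl = (if kl = (i, j) then s else 0) + (if kl = (j, i) then bar s else 0)"
    if "kl \<in> {..<n} \<times> {..<n}" for kl
    using that unfolding E_def by (cases kl) (simp only: mem_Sigma_iff lessThan_iff index_mat(1))
  have "E \<in> X n"
  proof (rule X_I)
    fix k l assume kl: "k < n" "l < n"
    show "E $$ (l, k) = bar (E $$ (k, l))"
      by (simp only: E_index mem_Sigma_iff lessThan_iff kl simp_thms prod.inject if_distrib[of bar]
          bar.hom_add bar_bar bar.hom_zero conj_commute add.commute)
  qed (simp add: E_def)
  moreover have "mat_inner D E = (\<Sum>kl\<in>{..<n} \<times> {..<n}.
      (if kl = (i, j) then D $$ kl * s else 0) + (if kl = (j, i) then D $$ kl * bar s else 0))"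
    unfolding mat_inner_def using D
    by (intro sum.cong)
      (simp_all only: E_index X_dim distrib_left if_distrib[of "(*) _"] mult_zero_right)
  then have "mat_inner D E = D $$ (i, j) * s + D $$ (j, i) * bar s"
    using ij by (simp add: sum.distrib)
  then have "mat_inner D E = 1"
    using s X_index[OF D ij(1,2)] by (simp add: field_trace_def mult.commute)
  ultimately show ?thesis by blast
qed

lemma sum_psi_mat_inner:
  assumes D: "D \<in> X n" and "D \<noteq> 0\<^sub>m n n"
  shows "(\<Sum>C\<in>X n. \<psi> (mat_inner D C)) = 0"
proof -
  obtain E where E: "E \<in> X n" "mat_inner D E = 1" using ex_mat_inner_eq_1[OF assms] by blast
  then have "\<psi> (mat_inner D (C + E)) = \<psi> 1 * \<psi> (mat_inner D C)" if "C \<in> X n" for C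
    using mat_inner_add_right[of D n n C E] X_carrier D that by (simp add: psi.add)
  then show ?thesis by (rule sum_eq_0_if_bij_scales[OF bij_betw_add_X[OF E(1)] _ psi_1])
qed

definition gram :: "nat \<Rightarrow> nat \<Rightarrow> (nat \<Rightarrow> 'a vec) \<Rightarrow> 'a mat" where
  "gram n t x = mat n n (\<lambda>(i, j). \<Sum>s<t. bar (x s $ i) * x s $ j)"

lemma gram_in_X: "gram n t x \<in> X n"
  by (rule X_I) (auto simp: gram_def mult.commute)

lemma mrank_le_if_add_gram_eq_0:
  assumes D: "D \<in> carrier_mat n n" and zero: "gram n t x + D = 0\<^sub>m n n"
  shows "mrank n D \<le> t"
proof -
  have "D = mat n n (\<lambda>(i, j). \<Sum>s<t. - bar (x s $ i) * x s $ j)"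
  proof (rule eq_matI)
    fix i j assume "i < dim_row (mat n n (\<lambda>(i, j). \<Sum>s<t. - bar (x s $ i) * x s $ j))"
      "j < dim_col (mat n n (\<lambda>(i, j). \<Sum>s<t. - bar (x s $ i) * x s $ j))"
    then have ij: "i < n" "j < n" by auto
    then have "gram n t x $$ (i, j) + D $$ (i, j) = 0"
      using arg_cong[OF zero, of "\<lambda>M. M $$ (i, j)"] D by simp
    then show "D $$ (i, j) = mat n n (\<lambda>(i, j). \<Sum>s<t. - bar (x s $ i) * x s $ j) $$ (i, j)"
      using ij by (simp add: gram_def sum_negf add_eq_0_iff)
  qed (use D in auto)
  then show ?thesis
    using mrank_sum_products_le[of n "\<lambda>s i. - bar (x s $ i)" "\<lambda>s j. x s $ j" t] by metis
qed

lemma herm_form_eq_sum: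
  assumes C: "C \<in> X n" and x: "x \<in> V n"
  shows "herm_form C x = (\<Sum>(i, j)\<in>{..<n} \<times> {..<n}. bar (x $ i) * x $ j * C $$ (i, j))"
proof -
  have "herm_form C x = (\<Sum>i<n. \<Sum>j<n. bar (x $ i) * x $ j * C $$ (i, j))"
    using C x by (simp add: herm_form_def herm_prod_def scalar_prod_def atLeast0LessThan
        sum_distrib_left mult_ac)
  then show ?thesis by (simp add: sum.cartesian_product)
qed

lemma mat_inner_gram:
  assumes C: "C \<in> X n" and x: "\<And>s. s < t \<Longrightarrow> x s \<in> V n"
  shows "mat_inner (gram n t x) C = (\<Sum>s<t. herm_form C (x s))"
proof -
  have "mat_inner (gram n t x) C
      = (\<Sum>(i, j)\<in>{..<n} \<times> {..<n}. \<Sum>s<t. bar (x s $ i) * x s $ j * C $$ (i, j))"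
    unfolding mat_inner_def by (intro sum.cong) (auto simp: gram_def sum_distrib_right)
  also have "\<dots> = (\<Sum>s<t. \<Sum>(i, j)\<in>{..<n} \<times> {..<n}. bar (x s $ i) * x s $ j * C $$ (i, j))"
    unfolding case_prod_unfold by (rule sum.swap)
  also have "\<dots> = (\<Sum>s<t. herm_form C (x s))"
    using C x by (intro sum.cong refl) (simp add: herm_form_eq_sum)
  finally show ?thesis .
qed

lemma gauss_sum_power:
  assumes C: "C \<in> X n"
  shows "gauss_sum C ^ t = (\<Sum>x\<in>{..<t} \<rightarrow>\<^sub>E V n. \<psi> (mat_inner (gram n t x) C))"
proof -
  have "gauss_sum C ^ t = (\<Prod>s<t. \<Sum>x\<in>V n. \<psi> (herm_form C x))"
    using C by (simp add: gauss_sum_def)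
  also have "\<dots> = (\<Sum>x\<in>{..<t} \<rightarrow>\<^sub>E V n. \<Prod>s<t. \<psi> (herm_form C (x s)))"
    by (intro prod_sum_PiE) auto
  also have "\<dots> = (\<Sum>x\<in>{..<t} \<rightarrow>\<^sub>E V n. \<psi> (mat_inner (gram n t x) C))"
    using C by (intro sum.cong refl) (subst mat_inner_gram, auto simp: psi.sum)
  finally show ?thesis .
qed

lemma fourier_gauss_sum_power_eq_0:
  assumes D: "D \<in> X n" and t: "t < mrank n D"
  shows "(\<Sum>C\<in>X n. gauss_sum C ^ t * \<psi> (mat_inner D C)) = 0"
proof -
  have "(\<Sum>C\<in>X n. gauss_sum C ^ t * \<psi> (mat_inner D C))
      = (\<Sum>C\<in>X n. \<Sum>x\<in>{..<t} \<rightarrow>\<^sub>E V n. \<psi> (mat_inner (gram n t x + D) C))"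
    by (intro sum.cong refl)
      (simp add: gauss_sum_power sum_distrib_right psi.add
        mat_inner_add_left[OF X_carrier[OF gram_in_X] X_carrier[OF D]])
  also have "\<dots> = (\<Sum>x\<in>{..<t} \<rightarrow>\<^sub>E V n. \<Sum>C\<in>X n. \<psi> (mat_inner (gram n t x + D) C))"
    by (rule sum.swap)
  also have "\<dots> = 0"
  proof (rule sum.neutral, rule ballI, rule sum_psi_mat_inner)
    fix x
    show "gram n t x + D \<in> X n" using gram_in_X D by (rule X_add)
    show "gram n t x + D \<noteq> 0\<^sub>m n n"
      using mrank_le_if_add_gram_eq_0[OF X_carrier[OF D], of t x] t by auto
  qed
  finally show ?thesis .
qed

lemma fourier_poly_zeta_eq_0:
  assumes D: "D \<in> X n" and P: "degree P < mrank n D"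
  shows "(\<Sum>C\<in>X n. of_real (poly P (zeta C)) * \<psi> (mat_inner D C)) = 0"
proof -
  let ?c = "\<lambda>t. complex_of_real (coeff P t / b ^ (n * t))"
  have "complex_of_real (poly P (zeta C)) = (\<Sum>t\<le>degree P. ?c t * gauss_sum C ^ t)"
    if C: "C \<in> X n" for C
  proof -
    have "complex_of_real (coeff P t * zeta C ^ t) = ?c t * gauss_sum C ^ t" for t
      unfolding gauss_sum_eq_zeta[OF C] of_real_power[symmetric] of_real_mult[symmetric]
        of_real_eq_iff
      using b_nonzero by (simp add: power_mult_distrib flip: power_mult)
    then show ?thesis by (simp add: poly_altdef)
  qed
  then have "(\<Sum>C\<in>X n. of_real (poly P (zeta C)) * \<psi> (mat_inner D C))
      = (\<Sum>C\<in>X n. \<Sum>t\<le>degree P. ?c t * (gauss_sum C ^ t * \<psi> (mat_inner D C)))"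
    by (simp add: sum_distrib_right mult.assoc)
  also have "\<dots> = (\<Sum>t\<le>degree P. ?c t * (\<Sum>C\<in>X n. gauss_sum C ^ t * \<psi> (mat_inner D C)))"
    by (subst sum.swap) (simp add: sum_distrib_left)
  also have "\<dots> = 0" using P by (intro sum.neutral) (auto simp: fourier_gauss_sum_power_eq_0[OF D])
  finally show ?thesis .
qed

lemma zeta_zero_mat: "zeta (0\<^sub>m n n) = b ^ n"
proof (rule zeta_eqI[OF zero_in_X])
  have "herm_form (0\<^sub>m n n) x = 0" if "x \<in> V n" for x
    using that by (auto simp: herm_form_eq_sum[OF zero_in_X] intro!: sum.neutral)
  then have "gauss_sum (0\<^sub>m n n) = of_nat (q ^ (2 * n))"
    by (simp add: gauss_sum_def card_V)
  also have "real (q ^ (2 * n)) = b ^ n * b ^ n"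
    by (simp add: power_mult power2_eq_square flip: power_mult_distrib)
  then have "of_nat (q ^ (2 * n)) = complex_of_real (b ^ n * b ^ n)"
    by (metis of_real_of_nat_eq)
  finally show "gauss_sum (0\<^sub>m n n) = of_real (b ^ n * b ^ n)" .
qed

lemma d_code_polynomial_bound:
  fixes Y :: "'a mat set"
  assumes Y: "is_d_code n q d Y" and P: "degree P < d"
    and nonneg: "\<And>k. k \<le> n \<Longrightarrow> poly P (b ^ k) \<ge> 0"
  shows "real (card Y) * poly P (b ^ n) \<le> (\<Sum>C\<in>X n. poly P (zeta C))"
proof -
  have Y_X: "Y \<subseteq> X n" and "Y \<noteq> {}" using Y by (auto simp: is_d_code_def)
  have "real (card Y) * poly P (zeta (0\<^sub>m n n)) \<le> (\<Sum>C\<in>X n. poly P (zeta C))"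
  proof (rule delsarte_bound[where \<chi> = "\<lambda>A C. \<psi> (mat_inner A C)"])
    show "finite Y" using finite_subset[OF Y_X finite_X] .
    show "poly P (zeta C) \<ge> 0" if "C \<in> X n" for C
      using zeta_eq_power[OF that] nonneg by auto
    show "\<psi> (mat_inner A (0\<^sub>m n n)) = 1" if "A \<in> Y" for A
      using X_carrier[of A n] Y_X that by auto
    show "(\<Sum>C\<in>X n. of_real (poly P (zeta C)) * (\<psi> (mat_inner A C) * cnj (\<psi> (mat_inner B C)))) = 0"
      if AB: "A \<in> Y" "B \<in> Y" "A \<noteq> B" for A B
    proof -
      have "A \<in> X n" "B \<in> X n" using AB Y_X by auto
      moreover have "degree P < mrank n (A - B)"
        using Y P AB by (auto simp: is_d_code_def intro: less_le_trans)
      ultimately show ?thesis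
        using fourier_poly_zeta_eq_0[OF X_diff]
        by (simp add: mat_inner_diff_left[OF X_carrier X_carrier] flip: psi.diff)
    qed
  qed (use \<open>Y \<noteq> {}\<close> in \<open>auto simp: finite_X zero_in_X\<close>)
  then show ?thesis by (simp add: zeta_zero_mat)
qed

end

subsection \<open>The extremal polynomial\<close>

lemma sign_power_diff_pos:
  fixes b :: real
  assumes "b < - 1" and "s < k"
  shows "(- 1) ^ k * (b ^ k - b ^ s) > 0"
proof -
  have "\<bar>(- 1) ^ k * b ^ s\<bar> = (- b) ^ s"
    using assms(1) by (simp add: abs_mult power_abs)
  also have "\<dots> < (- b) ^ k"
    using assms by (intro power_strict_increasing) auto
  also have "(- b) ^ k = (- 1) ^ k * b ^ k" by (rule power_minus)
  finally show ?thesis by (simp add: right_diff_distrib abs_less_iff)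
qed

lemma gauss_poly_power_pos:
  fixes b :: real
  assumes "b < - 1" and "even r" and "r \<le> k"
  shows "poly (gauss_poly b r) (b ^ k) > 0"
proof -
  have "0 < (\<Prod>s<r. (- 1) ^ k * (b ^ k - b ^ s))"
    using assms by (intro prod_pos) (auto intro: sign_power_diff_pos)
  also have "\<dots> = ((- 1) ^ k) ^ r * poly (gauss_poly b r) (b ^ k)"
    by (simp add: prod.distrib poly_gauss_poly)
  also have "((- 1 :: real) ^ k) ^ r = 1"
    using assms(2) by (simp flip: power_mult)
  finally show ?thesis by simp
qed

lemma gauss_poly_power_eq_0:
  fixes b :: "'a::idom"
  shows "k < r \<Longrightarrow> poly (gauss_poly b r) (b ^ k) = 0"
  by (auto simp: poly_gauss_poly)

text \<open>With \<open>z = b ^ (n - k)\<close> for a matrix of rank \<open>k\<close>, the roots are the ranks above \<open>n - d + 2\<close>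
  and the rank 1; the sign \<open>(- 1) ^ n\<close> makes the values at all other ranks positive.\<close>

definition code_poly :: "real \<Rightarrow> nat \<Rightarrow> nat \<Rightarrow> real poly" where
  "code_poly b n d = Polynomial.smult ((- 1) ^ n) (gauss_poly b (d - 2) * [:- (b ^ (n - 1)), 1:])"

lemma poly_code_poly:
  "poly (code_poly b n d) z = (- 1) ^ n * (poly (gauss_poly b (d - 2)) z * (z - b ^ (n - 1)))"
  by (simp add: code_poly_def algebra_simps)

lemma degree_code_poly:
  assumes "2 \<le> d"
  shows "degree (code_poly b n d) < d"
  using assms degree_mult_le[of "gauss_poly b (d - 2)" "[:- (b ^ (n - 1)), 1:]"]
  by (simp add: code_poly_def degree_gauss_poly)

lemma code_poly_power_nonneg:
  assumes "b < - 1" and "even d" and "0 < n" and "k \<le> n"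
  shows "poly (code_poly b n d) (b ^ k) \<ge> 0"
proof -
  obtain m where m: "n = Suc m" using \<open>0 < n\<close> by (cases n) auto
  have sign: "(- 1) ^ n * (b ^ k - b ^ (n - 1)) \<ge> 0"
  proof -
    consider "k = Suc m" | "k = m" | "k < m" using \<open>k \<le> n\<close> m by linarith
    then show ?thesis
    proof cases
      case 1
      then show ?thesis using sign_power_diff_pos[OF assms(1), of m "Suc m"] by (simp add: m)
    next
      case 3
      then show ?thesis
        using sign_power_diff_pos[OF assms(1), of k m] by (simp add: m right_diff_distrib)
    qed (simp add: m)
  qed
  have "poly (gauss_poly b (d - 2)) (b ^ k) \<ge> 0"
    using gauss_poly_power_pos[of b "d - 2" k] gauss_poly_power_eq_0[of k "d - 2" b] assms(1,2)
    by (cases "d - 2 \<le> k") auto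
  from mult_nonneg_nonneg[OF this sign] show ?thesis
    unfolding poly_code_poly by (simp only: mult.left_commute)
qed

context hermitian_forms
begin

context
  fixes n d :: nat
  assumes even_d: "even d" and two_le_d: "2 \<le> d" and d_le_n: "d \<le> n"
begin

lemma power_n_split: "b ^ n = b ^ (d - 2) * b ^ (n - d + 2)"
proof -
  have "n = d - 2 + (n - d + 2)" using two_le_d d_le_n by simp
  then show ?thesis by (metis power_add)
qed

lemma power_n_minus_1_split: "b ^ (n - 1) = b ^ (d - 2) * b ^ (n - d + 1)"
proof -
  have "n - 1 = d - 2 + (n - d + 1)" using two_le_d d_le_n by simp
  then show ?thesis by (metis power_add)
qed

lemma sum_code_poly:
  "(\<Sum>C\<in>X n. poly (code_poly b n d) (zeta C))
    = - (poly (gauss_poly b (d - 2)) (b ^ n) * b ^ (d - 2) * b ^ (n * (n - d + 1))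
      * ((b ^ (n - d + 2) - 1) + b ^ n * (b ^ (n - d + 1) - 1)))"
proof -
  let ?r = "d - 2" and ?g = "poly (gauss_poly b (d - 2)) (b ^ n)" and ?w = "b ^ (n * (n - d + 1))"
  let ?e = "(- 1) ^ n :: real"
  have "even ?r" using even_d by simp
  then have signs: "(- 1) ^ ?r = (1 :: real)" "(- 1) ^ Suc ?r = (- 1 :: real)" by simp_all
  have "?r \<le> n" "Suc ?r \<le> n" and "n - ?r = Suc (n - d + 1)" "n - Suc ?r = n - d + 1"
    using two_le_d d_le_n by simp_all
  then have moment: "gauss_moment n ?r = ?e * (?w * b ^ n * ?g)"
    "gauss_moment n (Suc ?r) = - ?e * (?w * (?g * (b ^ n - b ^ ?r)))"
    by (simp_all only: gauss_moment_eq poly_gauss_poly_Suc mult_Suc_right power_add signs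
        mult_1_left mult_minus_left mult_minus_right mult_ac)
  have "poly (code_poly b n d) z = ?e * (poly (gauss_poly b (Suc ?r)) z
      + (b ^ ?r - b ^ (n - 1)) * poly (gauss_poly b ?r) z)" for z
    by (simp add: poly_code_poly poly_gauss_poly_Suc algebra_simps)
  then have "(\<Sum>C\<in>X n. poly (code_poly b n d) (zeta C))
      = ?e * (gauss_moment n (Suc ?r) + (b ^ ?r - b ^ (n - 1)) * gauss_moment n ?r)"
    by (simp add: gauss_moment_def sum.distrib sum_distrib_left distrib_left)
  also have "\<dots> = (?e * ?e) * (?g * ?w * ((b ^ ?r - b ^ n) + (b ^ ?r - b ^ (n - 1)) * b ^ n))"
    unfolding moment by (simp add: algebra_simps)
  also have "?e * ?e = 1" by (simp flip: power_mult_distrib)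
  also have "(b ^ ?r - b ^ n) + (b ^ ?r - b ^ (n - 1)) * b ^ n
      = - (b ^ ?r * ((b ^ (n - d + 2) - 1) + b ^ n * (b ^ (n - d + 1) - 1)))"
  proof -
    have "b ^ ?r - b ^ n = - (b ^ ?r * (b ^ (n - d + 2) - 1))"
      by (simp add: power_n_split right_diff_distrib)
    moreover have "b ^ ?r - b ^ (n - 1) = - (b ^ ?r * (b ^ (n - d + 1) - 1))"
      by (simp only: power_n_minus_1_split) (simp add: right_diff_distrib)
    ultimately show ?thesis
      by (simp only: distrib_left mult_minus_left minus_add_distrib mult_ac)
  qed
  finally show ?thesis by (simp only: mult_1_left mult_minus_right mult_ac)
qed

lemma poly_code_poly_power_n:
  "poly (code_poly b n d) (b ^ n)
    = poly (gauss_poly b (d - 2)) (b ^ n) * b ^ (d - 2)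
      * ((- 1) ^ n * (b ^ (n - d + 2) - b ^ (n - d + 1)))"
proof -
  have "b ^ n - b ^ (n - 1) = b ^ (d - 2) * (b ^ (n - d + 2) - b ^ (n - d + 1))"
    by (simp only: power_n_split power_n_minus_1_split right_diff_distrib)
  then show ?thesis by (simp only: poly_code_poly mult_ac)
qed

lemma d_code_bound:
  fixes Y :: "'a mat set"
  assumes Y: "is_d_code n q d Y"
  shows "real (card Y) \<le> (- 1) ^ (n + 1) * real q ^ (n * (n - d + 1)) *
    (((b ^ (n - d + 2) - 1) + b ^ n * (b ^ (n - d + 1) - 1)) / (b ^ (n - d + 2) - b ^ (n - d + 1)))"
proof -
  let ?N = "(b ^ (n - d + 2) - 1) + b ^ n * (b ^ (n - d + 1) - 1)"
    and ?D = "b ^ (n - d + 2) - b ^ (n - d + 1)"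
  let ?k = "poly (gauss_poly b (d - 2)) (b ^ n) * b ^ (d - 2)"
  have b_less: "b < - 1" using q_gt_1 by simp
  have "real (card Y) * poly (code_poly b n d) (b ^ n) \<le> (\<Sum>C\<in>X n. poly (code_poly b n d) (zeta C))"
    using even_d two_le_d d_le_n b_less
    by (intro d_code_polynomial_bound[OF Y] degree_code_poly code_poly_power_nonneg) auto
  then have "?k * (real (card Y) * ((- 1) ^ n * ?D)) \<le> ?k * - (b ^ (n * (n - d + 1)) * ?N)"
    unfolding sum_code_poly poly_code_poly_power_n by (simp only: mult_ac mult_minus_right)
  moreover have "?k > 0"
    using gauss_poly_power_pos[OF b_less, of "d - 2" n] even_d d_le_n q_gt_1 by simp
  ultimately have "real (card Y) * ((- 1) ^ n * ?D) \<le> - (b ^ (n * (n - d + 1)) * ?N)"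
    by (simp only: mult_le_cancel_left_pos)
  moreover have "(- 1 :: real) ^ n = (- 1) ^ (n - d + 2)"
    using even_d d_le_n by (simp add: minus_one_power_iff)
  then have "(- 1) ^ n * ?D > 0"
    using sign_power_diff_pos[OF b_less, of "n - d + 1" "n - d + 2"] by simp
  ultimately have "real (card Y) \<le> - (b ^ (n * (n - d + 1)) * ?N) / ((- 1) ^ n * ?D)"
    by (simp only: pos_le_divide_eq)
  also have "\<dots> = (- 1) ^ (n + 1) * b ^ (n * (n - d + 1)) * (?N / ?D)"
  proof -
    have "- (w * N) / (e * D) = - e * w * (N / D)" if "e = 1 \<or> e = - 1" for e w N D :: real
      using that by auto
    from this[of "(- 1) ^ n"] show ?thesis by (simp add: minus_one_power_iff)
  qed
  also have "b ^ (n * (n - d + 1)) = real q ^ (n * (n - d + 1))"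
    using even_d d_le_n by simp
  finally show ?thesis .
qed

end

end

theorem theorem3p2:
  fixes Y :: "'a::{finite, field} mat set"
    and q n d :: nat
  assumes "\<exists>p k. prime p \<and> k > 0 \<and> q = p ^ k"
    and "card (UNIV :: 'a set) = q ^ 2"
    and "n \<ge> 2"
    and "even d" and "2 \<le> d" and "d \<le> n"
    and "is_d_code n q d Y"
  shows "real (card Y) \<le>
    (-1) ^ (n + 1) * real q ^ (n * (n - d + 1)) *
    ((((- real q) ^ (n - d + 2) - 1) + (- real q) ^ n * ((- real q) ^ (n - d + 1) - 1))
      / ((- real q) ^ (n - d + 2) - (- real q) ^ (n - d + 1)))"
proof -
  obtain p k where p: "prime p" and q: "q = p ^ k" using assms(1) by blast
  have "CHAR('a) dvd p ^ (k * 2)"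
    using CHAR_dvd_CARD[where ?'a = 'a] assms(2) q by (simp add: power_mult)
  then have char: "CHAR('a) = p"
    using p prime_CHAR_finite[where ?'a = 'a] by (metis prime_dvd_power primes_dvd_imp_eq)
  then have "CARD('a) = CHAR('a) ^ (k * 2)" using assms(2) q by (simp add: power_mult)
  then obtain \<psi> :: "'a \<Rightarrow> complex" where "additive_character \<psi>" "\<psi> 1 \<noteq> 1"
    using ex_nontrivial_additive_character by blast
  then interpret hermitian_forms q \<psi>
    using assms(2) q char
    by (auto simp: hermitian_forms_def hermitian_forms_axioms_def quadratic_extension_def)
  show ?thesis using assms(4-7) by (rule d_code_bound)
qed

end
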